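(* In the setting and under the assumptions stated in the context, let $u$ be the viscosity solution of $$\max\{u-\overline b,\ u_t+\overline H(Du)\}=0\ \text{in }\mathbb{R}^n\times(0,\infty),\qquad u(x,0)=g(x)\ \text{on }\mathbb{R}^n.$$ Then for all $x\in\mathbb{R}^n$ and $t\ge0$, $$u(x,t)=\begin{cases}\displaystyle\inf_{\tau\in[0,t),\,y\in\mathbb{R}^n}\left\{(t-\tau)\,\overline L\left(\frac{x-y}{t-\tau}\right)+f(y,\tau)\right\},& t>0,\\ g(x),& t=0.\end{cases}$$
   Context: $n\ge2$; $\Omega\subset\mathbb{R}^n$ is open, connected, $\mathbb{Z}^n$-periodic ($\Omega+\mathbb{Z}^n=\Omega$), with nonempty $C^1$ boundary. Assumptions: (1) $H\in C(\mathbb{R}^n\times\mathbb{R}^n)$, $\mathbb{Z}^n$-periodic in the first variable; (2) $\lim_{|p|\to\infty}\inf_yH(y,p)=+\infty$; (3) $p\mapsto H(y,p)$ convex for each $y$; (4) $b\in\mathrm{BUC}(\mathbb{R}^n\times\partial\Omega)$ and $b(x,y+z)=b(x,y)$ for $z\in\mathbb{Z}^n$; (5) $g\in\mathrm{BUC}(\mathbb{R}^n)\cap\mathrm{Lip}(\mathbb{R}^n)$ and $g\le\overline b$ on $\mathbb{R}^n$, where $\overline b(x)=\min_{z\in\partial\Omega}b(x,z)$. Here $\mathrm{BUC}$ = bounded uniformly continuous. Standing normalization: there is $K_0>0$ with $\frac{|p|^2}{2}-K_0\le H(y,p)\le\frac{|p|^2}{2}+K_0$ for all $(y,p)$. $\overline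 H(p)$ is the unique constant for which there is a $\mathbb{Z}^n$-periodic viscosity solution $v$ of the state-constraint cell problem $H(y,p+Dv)\le\overline H(p)$ in $\Omega$ (subsolution), $H(y,p+Dv)\ge\overline H(p)$ on $\overline\Omega$ (supersolution, tested relative to $\overline\Omega$). $\overline L$ is the Legendre transform of $\overline H$: $\overline L(v)=\sup_p(p\cdot v-\overline H(p))$; it satisfies $\frac{|v|^2}{2}-K_0\le\overline L(v)\le\frac{|v|^2}{2}+K_0$, and likewise $\overline H$. $f:\mathbb{R}^n\times[0,\infty)\to\mathbb{R}$ is defined by $f(x,0)=g(x)$ and $f(x,t)=\overline b(x)$ for $t>0$. The limit problem is taken to be well-posed: $u$ denotes its unique (uniformly continuous) viscosity solution. *)

theory Defs
  imports "HOL-Analysis.Analysis" "HOL-Library.Set_Algebras"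
begin

definition integer_lattice :: "(real^'n) set" where
  "integer_lattice = {z. \<forall>i. z $ i \<in> \<int>}"

definition C1_function :: "('a::euclidean_space \<Rightarrow> real) \<Rightarrow> bool" where
  "C1_function \<phi> \<longleftrightarrow>
     (\<exists>D. continuous_on UNIV D \<and> (\<forall>x. GDERIV \<phi> x :> D x))"

text \<open>
  Near each boundary point the domain is the strict epigraph of a \<open>C\<^sup>1\<close> function in some
  system of orthonormal coordinates.  The unit vector \<open>e\<close> is the vertical direction; the function of
  the remaining \<open>n - 1\<close> coordinates is encoded as a function \<open>\<gamma>\<close> on the whole space that is
  evaluated only at the orthogonal projection of \<open>y\<close> to the hyperplane \<open>e\<^sup>\<bottom>\<close>.
\<close>
definition C1_boundary :: "('a::euclidean_space) set \<Rightarrow> bool" where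
  "C1_boundary \<Omega> \<longleftrightarrow>
     (\<forall>x\<in>frontier \<Omega>. \<exists>r>0. \<exists>e \<gamma>. norm e = 1 \<and> C1_function \<gamma> \<and>
        \<Omega> \<inter> ball x r = {y \<in> ball x r. \<gamma> (y - (y \<bullet> e) *\<^sub>R e) < y \<bullet> e})"

definition BUC_on :: "('a::metric_space) set \<Rightarrow> ('a \<Rightarrow> real) \<Rightarrow> bool" where
  "BUC_on S h \<longleftrightarrow> uniformly_continuous_on S h \<and> bounded (h ` S)"

text \<open>
  Viscosity sub- and supersolutions of \<open>F(x, v, Dv) = 0\<close> on a set \<open>S\<close>.  The function \<open>v - \<phi>\<close> is
  compared with its value at \<open>x\<close> only on \<open>S\<close>: this is the usual notion if \<open>S\<close> is open, and the
  state-constraint notion if \<open>S\<close> is the closure of a domain.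
\<close>
definition viscosity_subsolution ::
    "('a::euclidean_space \<Rightarrow> real \<Rightarrow> 'a \<Rightarrow> real) \<Rightarrow> 'a set \<Rightarrow> ('a \<Rightarrow> real) \<Rightarrow> bool" where
  "viscosity_subsolution F S v \<longleftrightarrow>
     (\<forall>\<phi> x q. C1_function \<phi> \<longrightarrow> x \<in> S \<longrightarrow> GDERIV \<phi> x :> q \<longrightarrow>
        (\<forall>\<^sub>F y in at x within S. v y - \<phi> y \<le> v x - \<phi> x) \<longrightarrow> F x (v x) q \<le> 0)"

definition viscosity_supersolution ::
    "('a::euclidean_space \<Rightarrow> real \<Rightarrow> 'a \<Rightarrow> real) \<Rightarrow> 'a set \<Rightarrow> ('a \<Rightarrow> real) \<Rightarrow> bool" where
  "viscosity_supersolution F S v \<longleftrightarrow>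
     (\<forall>\<phi> x q. C1_function \<phi> \<longrightarrow> x \<in> S \<longrightarrow> GDERIV \<phi> x :> q \<longrightarrow>
        (\<forall>\<^sub>F y in at x within S. v y - \<phi> y \<ge> v x - \<phi> x) \<longrightarrow> F x (v x) q \<ge> 0)"

definition cell_solution ::
    "(real^'n \<Rightarrow> real^'n \<Rightarrow> real) \<Rightarrow> (real^'n) set \<Rightarrow> real^'n \<Rightarrow> real \<Rightarrow> (real^'n \<Rightarrow> real) \<Rightarrow> bool" where
  "cell_solution H \<Omega> p c v \<longleftrightarrow>
     continuous_on (closure \<Omega>) v \<and>
     (\<forall>y\<in>closure \<Omega>. \<forall>z\<in>integer_lattice. v (y + z) = v y) \<and>
     viscosity_subsolution (\<lambda>y _ q. H y (p + q) - c) \<Omega> v \<and>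
     viscosity_supersolution (\<lambda>y _ q. H y (p + q) - c) (closure \<Omega>) v"

text \<open>\<open>Hbar p\<close> is the unique constant for which the cell problem at \<open>p\<close> is solvable.\<close>
definition effective_hamiltonian ::
    "(real^'n \<Rightarrow> real^'n \<Rightarrow> real) \<Rightarrow> (real^'n) set \<Rightarrow> (real^'n \<Rightarrow> real) \<Rightarrow> bool" where
  "effective_hamiltonian H \<Omega> Hbar \<longleftrightarrow>
     (\<forall>p c. (\<exists>v. cell_solution H \<Omega> p c v) \<longleftrightarrow> c = Hbar p)"

definition legendre :: "('a::real_inner \<Rightarrow> real) \<Rightarrow> 'a \<Rightarrow> real" where
  "legendre h v = (SUP p. p \<bullet> v - h p)"

definition bbar :: "(real^'n \<Rightarrow> real^'n \<Rightarrow> real) \<Rightarrow> (real^'n) set \<Rightarrow> real^'n \<Rightarrow> real" where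
  "bbar b \<Omega> x = (INF z\<in>frontier \<Omega>. b x z)"

text \<open>Under the standing assumptions on \<open>\<Omega>\<close> and \<open>b\<close> the infimum is a minimum.\<close>
lemma bbar_attained:
  fixes b :: "real^'n \<Rightarrow> real^'n \<Rightarrow> real"
  assumes per: "\<Omega> + integer_lattice = \<Omega>" and ne: "frontier \<Omega> \<noteq> {}"
    and buc: "BUC_on (UNIV \<times> frontier \<Omega>) (\<lambda>(x, y). b x y)"
    and bper: "\<And>x y z. y \<in> frontier \<Omega> \<Longrightarrow> z \<in> integer_lattice \<Longrightarrow> b x (y + z) = b x y"
  obtains z where "z \<in> frontier \<Omega>" "bbar b \<Omega> x = b x z" "\<And>y. y \<in> frontier \<Omega> \<Longrightarrow> bbar b \<Omega> x \<le> b x y"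
proof -
  have neg: "- z \<in> integer_lattice" if "z \<in> integer_lattice" for z :: "real^'n"
    using that by (auto simp: integer_lattice_def)
  have shift: "(+) z ` \<Omega> = \<Omega>" if z: "z \<in> integer_lattice" for z
  proof -
    have *: "w + y \<in> \<Omega>" if "w \<in> integer_lattice" "y \<in> \<Omega>" for w y
      using per that by (metis add.commute set_plus_intro)
    have "y \<in> (+) z ` \<Omega>" if "y \<in> \<Omega>" for y
      using *[OF neg[OF z] that] by (auto intro!: image_eqI[where x = "- z + y"])
    with * z show ?thesis by auto
  qed
  have fshift: "y + z \<in> frontier \<Omega>" if "y \<in> frontier \<Omega>" "z \<in> integer_lattice" for y z
    using that frontier_translation[of z \<Omega>] shift[of z] by (metis add.commute imageI)
  define K where "K = frontier \<Omega> \<inter> cbox 0 (\<chi> i. 1)"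
  have red: "\<exists>y'\<in>K. b x y' = b x y" if y: "y \<in> frontier \<Omega>" for y
  proof -
    define z :: "real^'n" where "z = (\<chi> i. - of_int \<lfloor>y $ i\<rfloor>)"
    have z: "z \<in> integer_lattice" by (simp add: z_def integer_lattice_def)
    have "y + z \<in> cbox 0 (\<chi> i. 1)"
      by (auto simp: mem_box_cart z_def) linarith
    with fshift[OF y z] bper[OF y z] show ?thesis by (auto simp: K_def)
  qed
  have "compact K" unfolding K_def by (intro closed_Int_compact frontier_closed compact_cbox)
  moreover have "K \<noteq> {}" using ne red by auto
  moreover have "continuous_on K (b x)"
  proof -
    have "continuous_on (UNIV \<times> frontier \<Omega>) (\<lambda>(x, y). b x y)"
      using buc by (simp add: BUC_on_def uniformly_continuous_imp_continuous)
    moreover have "continuous_on K (\<lambda>y. (x, y))" by (intro continuous_intros)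
    moreover have "(\<lambda>y. (x, y)) ` K \<subseteq> UNIV \<times> frontier \<Omega>" by (auto simp: K_def)
    ultimately have "continuous_on K (\<lambda>y. case (x, y) of (x, y) \<Rightarrow> b x y)"
      by (rule continuous_on_compose2)
    then show ?thesis by simp
  qed
  ultimately obtain z where z: "z \<in> K" "\<And>y. y \<in> K \<Longrightarrow> b x z \<le> b x y"
    using continuous_attains_inf by metis
  have le: "b x z \<le> b x y" if "y \<in> frontier \<Omega>" for y
    using red[OF that] z(2) by metis
  have "bbar b \<Omega> x = b x z"
    unfolding bbar_def using z(1) le by (intro cInf_eq_minimum) (auto simp: K_def)
  with z le show thesis by (intro that[of z]) (auto simp: K_def)
qed

definition obstacle_solution ::
    "(real^'n \<Rightarrow> real) \<Rightarrow> (real^'n \<Rightarrow> real) \<Rightarrow> (real^'n \<Rightarrow> real) \<Rightarrow> (real^'n \<Rightarrow> real \<Rightarrow> real) \<Rightarrow> bool" where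
  "obstacle_solution \<beta> Hbar g u \<longleftrightarrow>
     uniformly_continuous_on (UNIV \<times> {0..}) (\<lambda>(x, t). u x t) \<and>
     (let F = (\<lambda>(x, t) r (q, s). max (r - \<beta> x) (s + Hbar q)) in
        viscosity_subsolution F (UNIV \<times> {0<..}) (\<lambda>(x, t). u x t) \<and>
        viscosity_supersolution F (UNIV \<times> {0<..}) (\<lambda>(x, t). u x t)) \<and>
     (\<forall>x. u x 0 = g x)"

text \<open>Well-posedness of the limit problem: solutions are compared on times \<open>t \<ge> 0\<close> only.\<close>
definition unique_obstacle_solution ::
    "(real^'n \<Rightarrow> real) \<Rightarrow> (real^'n \<Rightarrow> real) \<Rightarrow> (real^'n \<Rightarrow> real) \<Rightarrow> (real^'n \<Rightarrow> real \<Rightarrow> real) \<Rightarrow> bool" where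
  "unique_obstacle_solution \<beta> Hbar g u \<longleftrightarrow>
     obstacle_solution \<beta> Hbar g u \<and>
     (\<forall>w. obstacle_solution \<beta> Hbar g w \<longrightarrow> (\<forall>x. \<forall>t\<ge>0. w x t = u x t))"

definition stopping_cost ::
    "(real^'n \<Rightarrow> real) \<Rightarrow> (real^'n \<Rightarrow> real) \<Rightarrow> real^'n \<Rightarrow> real \<Rightarrow> real" where
  "stopping_cost g \<beta> x t = (if t = 0 then g x else \<beta> x)"

end

theory Submission
  imports Defs
begin

text \<open>
  By uniqueness it suffices that the value function of the optimal stopping problem solves the
  obstacle problem.  Since \<open>g \<le> bbar b \<Omega>\<close> and \<open>g\<close> is Lipschitz, this function is Lipschitz in time
  and uniformly continuous in space; dynamic programming along straight lines then gives the
  viscosity inequalities, provided that \<open>Hbar\<close> is the Legendre transform of its own, finite,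
  Legendre transform.  That requires three properties of \<open>Hbar\<close>.  The quadratic upper bound comes
  from testing a corrector at its minimum.  Convexity is Soner's comparison argument for the
  state-constraint problem, applied to two subsolutions at once.  For superlinear growth one
  cannot use the lower bound on \<open>H\<close> directly, as the maximum of a corrector may lie on the boundary,
  where the subsolution property is not tested (and holes in the domain do lower \<open>Hbar\<close>); instead,
  \<open>p \<bullet> y + v y\<close> is locally Lipschitz with a constant of order \<open>sqrt (Hbar p)\<close>, and connectedness
  of \<open>\<Omega>\<close> bounds its increment \<open>p $ i\<close> over a period by a multiple of that constant.
\<close>

section \<open>Convexity, periodicity and the interior cone condition\<close>

lemma C1_functionI:
  assumes "\<And>x. GDERIV \<phi> x :> D x" "continuous_on UNIV D"
  shows "C1_function \<phi>"
  using assms unfolding C1_function_def by blast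

lemma viscosity_subsolutionD:
  assumes "viscosity_subsolution F S v" "C1_function \<phi>" "x \<in> S" "GDERIV \<phi> x :> q"
    and "r > 0" "\<And>y. y \<in> S \<Longrightarrow> dist y x < r \<Longrightarrow> v y - \<phi> y \<le> v x - \<phi> x"
  shows "F x (v x) q \<le> 0"
proof -
  have "\<forall>\<^sub>F y in at x within S. v y - \<phi> y \<le> v x - \<phi> x"
    using assms(5,6) by (auto simp: eventually_at)
  with assms(1-4) show ?thesis unfolding viscosity_subsolution_def by blast
qed

lemma viscosity_supersolutionD:
  assumes "viscosity_supersolution F S v" "C1_function \<phi>" "x \<in> S" "GDERIV \<phi> x :> q"
    and "r > 0" "\<And>y. y \<in> S \<Longrightarrow> dist y x < r \<Longrightarrow> v y - \<phi> y \<ge> v x - \<phi> x"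
  shows "F x (v x) q \<ge> 0"
proof -
  have "\<forall>\<^sub>F y in at x within S. v y - \<phi> y \<ge> v x - \<phi> x"
    using assms(5,6) by (auto simp: eventually_at)
  with assms(1-4) show ?thesis unfolding viscosity_supersolution_def by blast
qed

lemma GDERIV_inner_right: "GDERIV (\<lambda>y. a \<bullet> y) x :> a"
  unfolding gderiv_def by (auto intro!: derivative_eq_intros simp: inner_commute)

lemma GDERIV_power2_norm_scaled:
  fixes a :: "'a::euclidean_space"
  shows "GDERIV (\<lambda>y. (norm (c *\<^sub>R (y - a) - e))\<^sup>2) x :> (2 * c) *\<^sub>R (c *\<^sub>R (x - a) - e)"
  unfolding gderiv_def power2_norm_eq_inner
  by (auto intro!: derivative_eq_intros simp: inner_commute algebra_simps)

text \<open>The separating hyperplane of the strict epigraph and a point of the graph cannot be vertical.\<close>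
lemma convex_on_UNIV_subgradient:
  fixes h :: "'a::euclidean_space \<Rightarrow> real"
  assumes "convex_on UNIV h"
  obtains v where "\<And>p. h p \<ge> h q + v \<bullet> (p - q)"
proof -
  define S where "S = {(p, r). h p < r}"
  have "convex S"
    unfolding convex_def
  proof (clarsimp simp: S_def)
    fix p r p' r' :: _ and s t :: real
    assume *: "h p < r" "h p' < r'" "0 \<le> s" "0 \<le> t" "s + t = 1"
    have "h (s *\<^sub>R p + t *\<^sub>R p') \<le> s * h p + t * h p'"
      using assms * by (auto simp: convex_on_def)
    also have "\<dots> < s * r + t * r'"
      using * by (cases "s = 0")
        (auto intro!: add_less_le_mono mult_strict_left_mono mult_left_mono)
    finally show "h (s *\<^sub>R p + t *\<^sub>R p') < s * r + t * r'" .
  qed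
  moreover have "(q, h q + 1) \<in> S" by (simp add: S_def)
  then have "S \<noteq> {}" by blast
  moreover have "S \<inter> {(q, h q)} = {}" by (auto simp: S_def)
  ultimately obtain a c where ac: "a \<noteq> 0" "\<forall>x\<in>S. a \<bullet> x \<le> c" "\<forall>x\<in>{(q, h q)}. a \<bullet> x \<ge> c"
    using separating_hyperplane_sets[of S "{(q, h q)}"] by auto
  obtain a1 a2 where a: "a = (a1, a2)" by (cases a)
  have le: "a1 \<bullet> p + a2 * r \<le> a1 \<bullet> q + a2 * h q" if "h p < r" for p r
  proof -
    have "a \<bullet> (p, r) \<le> a \<bullet> (q, h q)" using ac that by (force simp: S_def)
    then show ?thesis by (simp add: a inner_Pair)
  qed
  have "a2 \<le> 0" using le[of q "h q + 1"] by (simp add: algebra_simps)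
  moreover have "a2 \<noteq> 0"
  proof
    assume "a2 = 0"
    with le[of "q + a1" "h (q + a1) + 1"] have "a1 \<bullet> a1 \<le> 0" by (simp add: algebra_simps)
    then have "a1 = 0" using inner_gt_zero_iff[of a1] by argo
    with \<open>a2 = 0\<close> ac(1) a show False by (simp add: zero_prod_def)
  qed
  ultimately have neg: "a2 < 0" by simp
  have "h p \<ge> h q + ((-1 / a2) *\<^sub>R a1) \<bullet> (p - q)" for p
  proof (rule field_le_epsilon)
    \<comment> \<open>Points of the graph lie outside the strict epigraph, so the hyperplane
      inequality is used at height \<open>h p + e\<close>.\<close>
    fix e :: real assume "e > 0"
    then have "a1 \<bullet> (p - q) \<le> - a2 * (h p + e - h q)"
      using le[of p "h p + e"] by (simp add: algebra_simps)
    then have "a1 \<bullet> (p - q) / (- a2) \<le> h p + e - h q"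
      using neg by (subst pos_divide_le_eq) (auto simp: algebra_simps)
    then show "h q + ((-1 / a2) *\<^sub>R a1) \<bullet> (p - q) \<le> h p + e" by simp
  qed
  then show thesis using that by blast
qed

text \<open>\<open>S\<close> need not be bounded, but an integer translation moves each of its
  points into the unit cube, so the infimum is one over a compact set.\<close>

lemma periodic_attains_inf:
  fixes f :: "real^'n \<Rightarrow> real"
  assumes S: "closed S" "S \<noteq> {}" "\<And>y z. y \<in> S \<Longrightarrow> z \<in> integer_lattice \<Longrightarrow> y + z \<in> S"
    and f: "continuous_on S f" "\<And>y z. y \<in> S \<Longrightarrow> z \<in> integer_lattice \<Longrightarrow> f (y + z) = f y"
  obtains y where "y \<in> S" "\<And>x. x \<in> S \<Longrightarrow> f y \<le> f x"
proof -
  define K where "K = S \<inter> cbox 0 (\<chi> i. 1)"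
  have red: "\<exists>y'\<in>K. f y' = f y" if y: "y \<in> S" for y
  proof -
    define z :: "real^'n" where "z = (\<chi> i. - of_int \<lfloor>y $ i\<rfloor>)"
    have z: "z \<in> integer_lattice" by (simp add: z_def integer_lattice_def)
    have "y + z \<in> cbox 0 (\<chi> i. 1)"
      by (auto simp: mem_box_cart z_def) linarith
    with S(3)[OF y z] f(2)[OF y z] show ?thesis by (auto simp: K_def)
  qed
  have "compact K" unfolding K_def using S(1) by (intro closed_Int_compact compact_cbox)
  moreover have "K \<noteq> {}" using S(2) red by auto
  moreover have "continuous_on K f" using f(1) by (rule continuous_on_subset) (auto simp: K_def)
  ultimately obtain y where y: "y \<in> K" "\<And>x. x \<in> K \<Longrightarrow> f y \<le> f x"
    using continuous_attains_inf by metis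
  have "f y \<le> f x" if "x \<in> S" for x using red[OF that] y(2) by metis
  with y(1) show thesis by (intro that[of y]) (auto simp: K_def)
qed

section \<open>Lattice translations of the domain and its closure\<close>

lemma uminus_integer_lattice: "z \<in> integer_lattice \<Longrightarrow> - z \<in> integer_lattice"
  by (auto simp: integer_lattice_def)

lemma lattice_shift:
  fixes \<Omega> :: "(real^'n) set"
  assumes per: "\<Omega> + integer_lattice = \<Omega>" and z: "z \<in> integer_lattice"
  shows "(+) z ` \<Omega> = \<Omega>"
proof -
  have *: "w + y \<in> \<Omega>" if "w \<in> integer_lattice" "y \<in> \<Omega>" for w y
    using per that by (metis add.commute set_plus_intro)
  have "y \<in> (+) z ` \<Omega>" if "y \<in> \<Omega>" for y
    using *[OF uminus_integer_lattice[OF z] that] by (auto intro!: image_eqI[where x = "- z + y"])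
  with * z show ?thesis by auto
qed

lemma lattice_shift_closure:
  fixes \<Omega> :: "(real^'n) set"
  assumes "\<Omega> + integer_lattice = \<Omega>" "z \<in> integer_lattice" "y \<in> closure \<Omega>"
  shows "y + z \<in> closure \<Omega>"
  using closure_translation[of z \<Omega>] lattice_shift[OF assms(1,2)] assms(3)
  by (metis add.commute imageI)

text \<open>A uniform interior cone condition: one direction and one opening serve all points of the
  closure near \<open>z\<close>. Near a boundary point the graph of \<gamma> is Lipschitz, so a
  vertical step of length \<open>t\<close> leaves room for a further displacement shorter than a
  fixed fraction of \<open>t\<close>.\<close>

lemma C1_boundary_cone:
  fixes \<Omega> :: "('a::euclidean_space) set"
  assumes "open \<Omega>" "C1_boundary \<Omega>" "z \<in> closure \<Omega>"
  obtains r \<delta> e where "r > 0" "\<delta> > 0" 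
    "\<And>y t. y \<in> closure \<Omega> \<Longrightarrow> y \<in> ball z r \<Longrightarrow> 0 < t \<Longrightarrow> t < r \<Longrightarrow> ball (y + t *\<^sub>R e) (t * \<delta>) \<subseteq> \<Omega>"
proof (cases "z \<in> \<Omega>")
  case True
  then obtain d where d: "d > 0" "ball z d \<subseteq> \<Omega>" using \<open>open \<Omega>\<close> open_contains_ball by blast
  show thesis
  proof (rule that[of "d/2" 1 0])
    fix y t assume "y \<in> ball z (d/2)" "0 < t" "t < d/2"
    then have "ball (y + t *\<^sub>R 0) (t * 1) \<subseteq> ball z d"
      by (auto intro!: subsetI) (smt (verit, ccfv_SIG) dist_commute dist_triangle field_sum_of_halves)
    with d show "ball (y + t *\<^sub>R 0) (t * 1) \<subseteq> \<Omega>" by blast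
  qed (use d in auto)
next
  case False
  then have "z \<in> frontier \<Omega>" using assms by (simp add: frontier_def interior_open)
  then obtain R e \<gamma> where R: "R > 0" "norm e = 1" "C1_function \<gamma>"
    and eq: "\<Omega> \<inter> ball z R = {y \<in> ball z R. \<gamma> (y - (y \<bullet> e) *\<^sub>R e) < y \<bullet> e}"
    using assms unfolding C1_boundary_def by blast
  define \<pi> where "\<pi> = (\<lambda>y. y - (y \<bullet> e) *\<^sub>R e)"
  have \<pi>: "norm (\<pi> y) \<le> norm y" for y
  proof -
    have "(norm (\<pi> y))\<^sup>2 = (norm y)\<^sup>2 - (y \<bullet> e)\<^sup>2"
      using R(2) unfolding \<pi>_def power2_norm_eq_inner
      by (simp add: algebra_simps power2_eq_square inner_commute norm_eq_1)
    then show ?thesis by (smt (verit) norm_ge_zero power2_le_imp_le zero_le_power2)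
  qed
  have \<pi>_add: "\<pi> (y + t *\<^sub>R e + b) = \<pi> y + \<pi> b" for y t b
    using R(2) unfolding \<pi>_def by (simp add: algebra_simps norm_eq_1)
  have \<pi>_diff: "\<pi> (x - y) = \<pi> x - \<pi> y" for x y
    unfolding \<pi>_def by (simp add: algebra_simps)
  obtain D where D: "continuous_on UNIV D" "\<And>x. GDERIV \<gamma> x :> D x"
    using R(3) unfolding C1_function_def by blast
  \<comment> \<open>The projection is nonexpansive, so \<open>C\<close> contains the projections of
    all points of \<open>ball z R\<close>; compactness bounds the gradient there.\<close>
  define C where "C = cball (\<pi> z) R"
  have "compact (D ` C)" unfolding C_def
    by (intro compact_continuous_image continuous_on_subset[OF D(1)]) auto
  then obtain k where k: "\<And>x. x \<in> C \<Longrightarrow> norm (D x) \<le> k"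
    using compact_imp_bounded bounded_iff by (metis image_eqI)
  have "k \<ge> 0" using k[of "\<pi> z"] R(1) by (smt (verit) C_def centre_in_cball norm_ge_zero)
  have lip: "\<gamma> x - \<gamma> y \<le> k * norm (x - y)" if "x \<in> C" "y \<in> C" for x y
  proof -
    have "norm (\<gamma> x - \<gamma> y) \<le> k * norm (x - y)"
    proof (rule differentiable_bound[of C \<gamma> "\<lambda>x h. h \<bullet> D x"])
      show "convex C" by (simp add: C_def)
      fix x assume "x \<in> C"
      show "(\<gamma> has_derivative (\<lambda>h. h \<bullet> D x)) (at x within C)"
        using D(2)[of x] unfolding gderiv_def by (rule has_derivative_at_withinI)
      show "onorm (\<lambda>h. h \<bullet> D x) \<le> k"
      proof (rule onorm_le)
        fix h show "norm (h \<bullet> D x) \<le> k * norm h"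
          using Cauchy_Schwarz_ineq2[of h "D x"] mult_left_mono[OF k[OF \<open>x \<in> C\<close>], of "norm h"]
          by (simp add: mult.commute)
      qed
    qed (use that in auto)
    then show ?thesis by simp
  qed
  have cont: "continuous_on UNIV \<gamma>"
    using D(2) unfolding gderiv_def
    by (meson continuous_at_imp_continuous_on has_derivative_continuous)
  \<comment> \<open>Only the non-strict inequality survives on the closure; the vertical step
    restores strictness.\<close>
  have cl: "\<gamma> (\<pi> y) \<le> y \<bullet> e" if y: "y \<in> closure \<Omega>" "y \<in> ball z R" for y
  proof (rule ccontr)
    assume neg: "\<not> \<gamma> (\<pi> y) \<le> y \<bullet> e"
    define U where "U = ball z R \<inter> {x. x \<bullet> e < \<gamma> (\<pi> x)}"
    have "open U" unfolding U_def \<pi>_def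
      by (intro open_Int open_ball open_Collect_less continuous_intros
          continuous_on_compose2[OF cont]) auto
    then have "U \<inter> closure \<Omega> = {} \<longleftrightarrow> U \<inter> \<Omega> = {}" by (rule open_Int_closure_eq_empty)
    moreover have "y \<in> U" using y neg by (simp add: U_def)
    ultimately obtain x where "x \<in> \<Omega>" "x \<in> U" using y(1) by (metis IntI disjoint_iff)
    then have "x \<in> \<Omega> \<inter> ball z R" "x \<bullet> e < \<gamma> (\<pi> x)" by (auto simp: U_def)
    then show False unfolding eq by (simp add: \<pi>_def)
  qed
  show thesis
  \<comment> \<open>For \<open>norm b < t / (1 + k)\<close> the graph rises by at most
    \<open>k * norm b\<close>, whereas the height grows by at least \<open>t - norm b\<close>, which
    is larger. The three displacements, each below \<open>R/4\<close>, keep \<open>x\<close> in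
    \<open>ball z R\<close>.\<close>
  proof (rule that[of "R/4" "1 / (1 + k)" e])
    fix y t assume y: "y \<in> closure \<Omega>" "y \<in> ball z (R/4)" and t: "0 < t" "t < R/4"
    show "ball (y + t *\<^sub>R e) (t * (1 / (1 + k))) \<subseteq> \<Omega>"
    proof
      fix x assume x: "x \<in> ball (y + t *\<^sub>R e) (t * (1 / (1 + k)))"
      define b where "b = x - (y + t *\<^sub>R e)"
      have xb: "x = y + t *\<^sub>R e + b" by (simp add: b_def)
      have nb: "norm b < t / (1 + k)" using x by (simp add: b_def dist_norm norm_minus_commute)
      have nb': "norm b * (1 + k) < t" using nb \<open>k \<ge> 0\<close> by (simp add: pos_less_divide_eq)
      have "norm b \<le> norm b * (1 + k)" using \<open>k \<ge> 0\<close> by (simp add: algebra_simps)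
      then have nbt: "norm b < t" using nb' by simp
      have "norm (x - z) \<le> norm (y - z) + norm (t *\<^sub>R e) + norm b"
        unfolding xb by (smt (verit) norm_triangle_ineq add_diff_eq diff_add_eq)
      moreover have "norm (y - z) < R/4" using y by (simp add: dist_norm norm_minus_commute)
      ultimately have xz: "norm (x - z) < R" using nbt t R by simp
      have "\<gamma> (\<pi> x) - \<gamma> (\<pi> y) \<le> k * norm (\<pi> x - \<pi> y)"
      proof (rule lip)
        show "\<pi> x \<in> C" using \<pi>[of "x - z"] xz
          by (simp add: C_def dist_norm \<pi>_diff norm_minus_commute)
        show "\<pi> y \<in> C" using \<pi>[of "y - z"] \<open>norm (y - z) < R/4\<close> R(1)
          by (simp add: C_def dist_norm \<pi>_diff norm_minus_commute)
      qed
      also have "\<pi> x - \<pi> y = \<pi> b" unfolding xb \<pi>_add by simp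
      also have "k * norm (\<pi> b) \<le> k * norm b" using \<pi> \<open>k \<ge> 0\<close> by (intro mult_left_mono)
      finally have 1: "\<gamma> (\<pi> x) \<le> \<gamma> (\<pi> y) + k * norm b" by simp
      have "\<gamma> (\<pi> y) \<le> y \<bullet> e" using cl y R(1) by simp
      moreover have "x \<bullet> e = y \<bullet> e + t + b \<bullet> e"
        unfolding xb using R(2) by (simp add: algebra_simps norm_eq_1)
      moreover have "- norm b \<le> b \<bullet> e"
        using Cauchy_Schwarz_ineq2[of b e] R(2) by simp
      ultimately have "\<gamma> (\<pi> x) < x \<bullet> e" using 1 nb' by (simp add: algebra_simps)
      then have "x \<in> \<Omega> \<inter> ball z R"
        unfolding eq using xz by (simp add: \<pi>_def dist_norm norm_minus_commute)
      then show "x \<in> \<Omega>" by simp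
    qed
  qed (use R \<open>k \<ge> 0\<close> in auto)
qed

section \<open>Superlinear growth of the effective Hamiltonian\<close>

text \<open>This makes the barrier term of the test functions below continuously
  differentiable.\<close>

lemma DERIV_power2_pos_part: "((\<lambda>t::real. (max 0 t)\<^sup>2) has_real_derivative 2 * max 0 t) (at t)"
proof (cases t "0::real" rule: linorder_cases)
  case less
  have "((\<lambda>t::real. 0) has_real_derivative 2 * max 0 t) (at t)" using less by simp
  then show ?thesis
    by (rule has_field_derivative_transform_within_open[of _ _ _ "{..<0}"]) (use less in auto)
next
  case greater
  have "((\<lambda>t::real. t\<^sup>2) has_real_derivative 2 * max 0 t) (at t)"
    using greater by (auto intro!: derivative_eq_intros)
  then show ?thesis
    by (rule has_field_derivative_transform_within_open[of _ _ _ "{0<..}"]) (use greater in auto)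
next
  case equal
  have "((\<lambda>h::real. (max 0 h)\<^sup>2 / h) \<longlongrightarrow> 0) (at 0)"
  proof (rule Lim_null_comparison)
    show "\<forall>\<^sub>F h::real in at 0. norm ((max 0 h)\<^sup>2 / h) \<le> \<bar>h\<bar>"
      by (intro always_eventually) (auto simp: max_def power2_eq_square)
    show "((\<lambda>h::real. \<bar>h\<bar>) \<longlongrightarrow> 0) (at 0)" by (rule tendsto_rabs_zero) (rule tendsto_ident_at)
  qed
  then show ?thesis using equal by (simp add: DERIV_def)
qed

text \<open>A \<open>C\<^sup>1\<close> test function close to \<open>C * norm (x - y)\<close> on the ball of radius \<open>\<rho>\<close>,
  whose last term forces maxima of \<open>w - \<phi>\<close> away from the boundary of the ball of radius \<open>2 * \<rho>\<close>.\<close>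
lemma cone_test_function:
  fixes y :: "'a::euclidean_space" and C B \<rho> \<epsilon> :: real
  assumes "\<epsilon> > 0"
  defines "\<phi> \<equiv> \<lambda>x. C * sqrt ((norm (x - y))\<^sup>2 + \<epsilon>\<^sup>2) + B * (max 0 ((norm (x - y))\<^sup>2 - \<rho>\<^sup>2))\<^sup>2"
    and "D \<equiv> \<lambda>x. (C / sqrt ((norm (x - y))\<^sup>2 + \<epsilon>\<^sup>2) + 4 * B * max 0 ((norm (x - y))\<^sup>2 - \<rho>\<^sup>2)) *\<^sub>R (x - y)"
  shows "GDERIV \<phi> x :> D x" "C1_function \<phi>"
proof -
  show *: "GDERIV \<phi> x :> D x" for x
  proof -
    have pos: "(norm (x - y))\<^sup>2 + \<epsilon>\<^sup>2 > 0" using assms(1) by (simp add: add_nonneg_pos)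
    have n: "GDERIV (\<lambda>x. (norm (x - y))\<^sup>2) x :> 2 *\<^sub>R (x - y)"
      using GDERIV_power2_norm_scaled[of 1 y 0 x] by simp
    have "((\<lambda>s. C * sqrt (s + \<epsilon>\<^sup>2) + B * (max 0 (s - \<rho>\<^sup>2))\<^sup>2) has_real_derivative
        C * (inverse (sqrt (s + \<epsilon>\<^sup>2)) / 2) + B * (2 * max 0 (s - \<rho>\<^sup>2))) (at s)"
      if "s + \<epsilon>\<^sup>2 > 0" for s
    proof (intro DERIV_add DERIV_cmult)
      show "((\<lambda>s. sqrt (s + \<epsilon>\<^sup>2)) has_real_derivative inverse (sqrt (s + \<epsilon>\<^sup>2)) / 2) (at s)"
        using that by (auto intro!: derivative_eq_intros)
      have "((\<lambda>s. s - \<rho>\<^sup>2) has_real_derivative 1) (at s)" by (auto intro!: derivative_eq_intros)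
      from DERIV_chain2[OF DERIV_power2_pos_part this]
      show "((\<lambda>s. (max 0 (s - \<rho>\<^sup>2))\<^sup>2) has_real_derivative 2 * max 0 (s - \<rho>\<^sup>2)) (at s)" by simp
    qed
    note compose = GDERIV_DERIV_compose[OF n this[OF pos]]
    have "(C * (inverse R / 2) + B * (2 * m)) *\<^sub>R 2 *\<^sub>R (x - y) = (C / R + 4 * B * m) *\<^sub>R (x - y)"
      for R m :: real
      unfolding scaleR_scaleR
      by (rule arg_cong[where f = "\<lambda>c. c *\<^sub>R (x - y)"]) (simp add: inverse_eq_divide algebra_simps)
    then show ?thesis unfolding \<phi>_def D_def by (rule GDERIV_subst[OF compose])
  qed
  show "C1_function \<phi>"
  proof (rule C1_functionI[OF *])
    have "sqrt ((norm (x - y))\<^sup>2 + \<epsilon>\<^sup>2) \<noteq> 0" for x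
      using assms(1) by (simp add: add_nonneg_eq_0_iff)
    then show "continuous_on UNIV D" unfolding D_def by (intro continuous_intros) auto
  qed
qed

text \<open>The slope \<open>M + 1\<close> of the cone exceeds the bound \<open>M\<close> on
  gradients, so a maximum of \<open>w - \<phi>\<close> cannot lie far from the vertex: it is within
  \<open>M * \<epsilon>\<close> of \<open>y\<close>. Continuity of \<open>w\<close> at
  \<open>y\<close> then gives the estimate up to an arbitrary \<open>e\<close>.\<close>

lemma subsolution_lipschitz_ball:
  fixes w :: "'a::euclidean_space \<Rightarrow> real"
  assumes sub: "viscosity_subsolution (\<lambda>_ _ q. norm q - M) \<Omega> w"
    and cont: "continuous_on \<Omega> w" and "M \<ge> 0"
    and ball: "cball y (2 * \<rho>) \<subseteq> \<Omega>" "\<rho> > 0" and z: "dist z y \<le> \<rho>"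
  shows "w z - w y \<le> (M + 1) * dist z y"
proof (rule field_le_epsilon)
  fix e :: real assume "e > 0"
  define K where "K = cball y (2 * \<rho>)"
  have K: "compact K" "y \<in> K" "z \<in> K" "continuous_on K w"
    using ball z cont by (auto simp: K_def dist_commute intro: continuous_on_subset)
  have "bounded (w ` K)" using K by (intro compact_imp_bounded compact_continuous_image)
  then obtain W where W: "\<And>x. x \<in> K \<Longrightarrow> \<bar>w x\<bar> \<le> W" unfolding bounded_iff by auto
  have "\<exists>d>0. \<forall>x\<in>K. dist x y < d \<longrightarrow> dist (w x) (w y) < e / 2"
    using K(2,4) \<open>e > 0\<close> unfolding continuous_on_iff by (meson half_gt_zero)
  then obtain d where "d > 0" and wd: "\<And>x. x \<in> K \<Longrightarrow> dist x y < d \<Longrightarrow> dist (w x) (w y) < e / 2"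
    by blast
  have d: "w x \<le> w y + e / 2" if "x \<in> K" "dist x y < d" for x
    using wd[OF that] unfolding dist_real_def by linarith
  \<comment> \<open>Two bounds on \<open>\<epsilon> * (M + 1)\<close> are wanted: below
    \<open>d\<close> it puts the maximum where \<open>w\<close> is close to \<open>w y\<close>,
    below \<open>e / 2\<close> it pays for the smoothing of the cone.\<close>
  define m where "m = min (e / (2 * (M + 1))) (d / (M + 1))"
  define \<epsilon> where "\<epsilon> = min 1 (m / 2)"
  have M1: "M + 1 > 0" using \<open>M \<ge> 0\<close> by simp
  have "m > 0" using \<open>e > 0\<close> \<open>d > 0\<close> M1 by (simp add: m_def)
  then have \<epsilon>: "\<epsilon> > 0" "\<epsilon> \<le> 1" "\<epsilon> < m" by (auto simp: \<epsilon>_def)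
  then have "\<epsilon> < e / (2 * (M + 1))" "\<epsilon> < d / (M + 1)" by (auto simp: m_def)
  then have \<epsilon>e: "\<epsilon> * (M + 1) < e / 2" and \<epsilon>d: "\<epsilon> * (M + 1) < d"
    using M1 by (auto simp: field_simps)
  \<comment> \<open>At distance \<open>2 * \<rho>\<close> the barrier equals
    \<open>9 * \<rho> ^ 4 * B = 2 * W + M + 2\<close>. This exceeds the oscillation of
    \<open>w\<close> on \<open>K\<close> plus \<open>\<phi> y\<close>, so the maximum is not on the
    sphere.\<close>
  define B where "B = (2 * W + M + 2) / (9 * \<rho> ^ 4)"
  define \<phi> where "\<phi> = (\<lambda>x. (M + 1) * sqrt ((norm (x - y))\<^sup>2 + \<epsilon>\<^sup>2) + B * (max 0 ((norm (x - y))\<^sup>2 - \<rho>\<^sup>2))\<^sup>2)"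
  have "W \<ge> 0" using W[OF K(2)] by simp
  then have "B \<ge> 0" using ball(2) \<open>M \<ge> 0\<close> by (simp add: B_def)
  then have \<phi>_nonneg: "\<phi> x \<ge> 0" for x using M1 by (simp add: \<phi>_def)
  have \<phi>y: "\<phi> y = (M + 1) * \<epsilon>" using \<epsilon> by (simp add: \<phi>_def)
  have "continuous_on K (\<lambda>x. w x - \<phi> x)"
    unfolding \<phi>_def by (intro continuous_intros K)
  then obtain x1 where x1: "x1 \<in> K" and max: "\<And>x. x \<in> K \<Longrightarrow> w x - \<phi> x \<le> w x1 - \<phi> x1"
    using continuous_attains_sup[of K "\<lambda>x. w x - \<phi> x"] K by auto
  have "norm (x1 - y) \<noteq> 2 * \<rho>"
  proof
    assume *: "norm (x1 - y) = 2 * \<rho>"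
    have "(max 0 ((norm (x1 - y))\<^sup>2 - \<rho>\<^sup>2))\<^sup>2 = 9 * \<rho> ^ 4"
      unfolding * by (simp add: max_def power2_eq_square power4_eq_xxxx)
    then have "B * (max 0 ((norm (x1 - y))\<^sup>2 - \<rho>\<^sup>2))\<^sup>2 = 2 * W + M + 2"
      using ball(2) by (simp add: B_def)
    then have "\<phi> x1 \<ge> 2 * W + M + 2" using M1 by (simp add: \<phi>_def)
    moreover have "(M + 1) * \<epsilon> \<le> (M + 1) * 1" using \<epsilon> M1 by (intro mult_left_mono) auto
    moreover have "- W \<le> w y" "w x1 \<le> W" using W[OF K(2)] W[OF x1] by auto
    moreover define P where "P = (M + 1) * \<epsilon>"
    have "P \<le> M + 1" using \<open>(M + 1) * \<epsilon> \<le> (M + 1) * 1\<close> by (simp add: P_def)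
    moreover have "w y - P \<le> w x1 - \<phi> x1" using max[OF K(2)] unfolding \<phi>y P_def .
    ultimately show False by linarith
  qed
  then have x1': "norm (x1 - y) < 2 * \<rho>" using x1 by (simp add: K_def dist_norm norm_minus_commute)
  define s where "s = norm (x1 - y)"
  define R where "R = sqrt (s\<^sup>2 + \<epsilon>\<^sup>2)"
  have "s \<ge> 0" by (simp add: s_def)
  have R: "R > 0" "R \<le> s + \<epsilon>" using \<epsilon> \<open>s \<ge> 0\<close>
    by (auto simp: R_def add_nonneg_pos sqrt_add_le_add_sqrt[THEN order_trans])
  have "norm (((M + 1) / R + 4 * B * max 0 (s\<^sup>2 - \<rho>\<^sup>2)) *\<^sub>R (x1 - y)) - M \<le> 0"
  proof (rule viscosity_subsolutionD[OF sub])
    show "C1_function \<phi>" unfolding \<phi>_def by (rule cone_test_function[OF \<epsilon>(1)])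
    show "GDERIV \<phi> x1 :> ((M + 1) / R + 4 * B * max 0 (s\<^sup>2 - \<rho>\<^sup>2)) *\<^sub>R (x1 - y)"
      unfolding \<phi>_def R_def s_def by (rule cone_test_function[OF \<epsilon>(1)])
    show "x1 \<in> \<Omega>" using x1 ball by (auto simp: K_def)
    show "2 * \<rho> - norm (x1 - y) > 0" using x1' by simp
    fix x assume "dist x x1 < 2 * \<rho> - norm (x1 - y)"
    then have "x \<in> K" using norm_triangle_ineq[of "x - x1" "x1 - y"]
      by (simp add: K_def dist_norm norm_minus_commute)
    then show "w x - \<phi> x \<le> w x1 - \<phi> x1" by (rule max)
  qed
  \<comment> \<open>Dropping the nonnegative share of the barrier in the gradient leaves
    \<open>(M + 1) * s \<le> M * R\<close>, where \<open>R \<le> s + \<epsilon>\<close>.\<close>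
  moreover have "(M + 1) / R * s \<le> ((M + 1) / R + 4 * B * max 0 (s\<^sup>2 - \<rho>\<^sup>2)) * s"
    using \<open>B \<ge> 0\<close> \<open>s \<ge> 0\<close> by (intro mult_right_mono) auto
  moreover have "0 \<le> (M + 1) / R + 4 * B * max 0 (s\<^sup>2 - \<rho>\<^sup>2)" using \<open>B \<ge> 0\<close> R M1 by simp
  ultimately have "(M + 1) / R * s \<le> M" by (simp add: s_def)
  then have "(M + 1) * s \<le> M * R" using R by (simp add: field_simps)
  also have "\<dots> \<le> M * (s + \<epsilon>)" using R \<open>M \<ge> 0\<close> by (intro mult_left_mono)
  finally have "s \<le> M * \<epsilon>" by (simp add: algebra_simps)
  also have "\<dots> \<le> \<epsilon> * (M + 1)" using \<epsilon> by (simp add: algebra_simps)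
  finally have "dist x1 y < d" using \<epsilon>d by (simp add: s_def dist_norm)
  then have wx1: "w x1 \<le> w y + e / 2" using d x1 by simp
  have "norm (z - y) \<le> \<rho>" using z by (simp add: dist_norm)
  then have "(norm (z - y))\<^sup>2 \<le> \<rho>\<^sup>2" by (rule power_mono) simp
  then have "\<phi> z = (M + 1) * sqrt ((norm (z - y))\<^sup>2 + \<epsilon>\<^sup>2)" by (simp add: \<phi>_def)
  also have "\<dots> \<le> (M + 1) * (norm (z - y) + \<epsilon>)"
    using M1 \<epsilon> by (intro mult_left_mono) (auto simp: sqrt_add_le_add_sqrt[THEN order_trans])
  finally have "\<phi> z \<le> (M + 1) * dist z y + \<epsilon> * (M + 1)" by (simp add: dist_norm algebra_simps)
  then show "w z - w y \<le> (M + 1) * dist z y + e"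
    using max[OF K(3)] \<phi>_nonneg[of x1] wx1 \<epsilon>e by linarith
qed

text \<open>The constant has to serve all subsolutions at once. Having increments controlled in this
  way is an equivalence relation on \<Omega>; the local Lipschitz bound makes its classes open, and
  connectedness leaves a single class.\<close>

lemma subsolution_increment_bound:
  fixes \<Omega> :: "('a::euclidean_space) set"
  assumes \<Omega>: "open \<Omega>" "connected \<Omega>" and ab: "a \<in> \<Omega>" "b \<in> \<Omega>"
  obtains K where "\<And>M w. M \<ge> 0 \<Longrightarrow> continuous_on \<Omega> w \<Longrightarrow>
    viscosity_subsolution (\<lambda>_ _ q. norm q - M) \<Omega> w \<Longrightarrow> \<bar>w a - w b\<bar> \<le> K * (M + 1)"
proof -
  define G where "G = (\<lambda>M w. M \<ge> 0 \<and> continuous_on \<Omega> w \<and>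
    viscosity_subsolution (\<lambda>_ _ q. norm q - M) \<Omega> w)"
  define rel where "rel x y \<longleftrightarrow> (\<exists>K. \<forall>M w. G M w \<longrightarrow> \<bar>w x - w y\<bar> \<le> K * (M + 1))" for x y
  have "rel a b"
  proof (rule connected_equivalence_relation[OF \<Omega>(2) ab])
    show "rel y x" if "rel x y" for x y using that by (simp add: rel_def abs_minus_commute)
    show "rel x z" if "rel x y" "rel y z" for x y z
    proof -
      obtain K1 K2 where "\<And>M w. G M w \<Longrightarrow> \<bar>w x - w y\<bar> \<le> K1 * (M + 1)"
        "\<And>M w. G M w \<Longrightarrow> \<bar>w y - w z\<bar> \<le> K2 * (M + 1)"
        using \<open>rel x y\<close> \<open>rel y z\<close> unfolding rel_def by blast
      then have "\<bar>w x - w z\<bar> \<le> (K1 + K2) * (M + 1)" if "G M w" for M w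
        using that by (smt (verit) distrib_right)
      then show ?thesis unfolding rel_def by blast
    qed
    fix x assume "x \<in> \<Omega>"
    then obtain r where r: "r > 0" "cball x r \<subseteq> \<Omega>" using \<Omega>(1) open_contains_cball by blast
    define \<rho> where "\<rho> = r / 4"
    have \<rho>: "\<rho> > 0" "\<rho> < r" "3 * \<rho> < r" using r by (auto simp: \<rho>_def)
    have "rel x y" if "y \<in> ball x \<rho>" for y
    proof -
      have "\<bar>w x - w y\<bar> \<le> \<rho> * (M + 1)" if "G M w" for M w
      proof -
        have M: "M \<ge> 0" using that by (simp add: G_def)
        have "cball x (2 * \<rho>) \<subseteq> \<Omega>" using r \<rho> by (auto intro!: order_trans[OF _ r(2)])
        then have "w y - w x \<le> (M + 1) * dist y x"
          using that \<rho> \<open>y \<in> ball x \<rho>\<close>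
          by (intro subsolution_lipschitz_ball) (auto simp: G_def dist_commute)
        \<comment> \<open>The Lipschitz bound is one-sided, with the centre as reference point, so
          it is used again with centre \<open>y\<close>; \<open>3 * \<rho> < r\<close> keeps the
          larger ball about \<open>y\<close> inside \<Omega>.\<close>
        moreover have "cball y (2 * \<rho>) \<subseteq> cball x r"
        proof
          fix u assume "u \<in> cball y (2 * \<rho>)"
          then show "u \<in> cball x r"
            using \<open>y \<in> ball x \<rho>\<close> \<rho> dist_triangle[of x u y] by simp
        qed
        then have "w x - w y \<le> (M + 1) * dist x y"
          using that \<rho> \<open>y \<in> ball x \<rho>\<close> r(2)
          by (intro subsolution_lipschitz_ball[where \<Omega> = \<Omega> and \<rho> = \<rho>]) (auto simp: G_def)
        moreover have "(M + 1) * dist x y \<le> (M + 1) * \<rho>"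
          using M \<open>y \<in> ball x \<rho>\<close> by (intro mult_left_mono) auto
        ultimately show ?thesis by (simp add: dist_commute mult.commute abs_le_iff)
      qed
      then show ?thesis unfolding rel_def by blast
    qed
    moreover have "ball x \<rho> \<subseteq> \<Omega>" using r \<rho> by (auto intro!: order_trans[OF _ r(2)])
    ultimately show "\<exists>T. openin (top_of_set \<Omega>) T \<and> x \<in> T \<and> (\<forall>y\<in>T. rel x y)"
      using \<rho> by (intro exI[of _ "ball x \<rho>"]) (auto intro: open_subset)
  qed
  then show thesis using that unfolding rel_def G_def by blast
qed

text \<open>One \<open>K\<close> serves all \<open>p\<close> and \<open>c\<close>, so
  \<open>c\<close> grows at least quadratically in \<open>norm p\<close>. The truncation
  \<open>max 0\<close> keeps the gradient bound nonnegative when \<open>c + K0\<close> is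
  negative.\<close>

lemma cell_solution_coercive:
  fixes \<Omega> :: "(real^'n) set"
  assumes \<Omega>: "open \<Omega>" "connected \<Omega>" "\<Omega> + integer_lattice = \<Omega>" "\<Omega> \<noteq> {}"
    and H_ge: "\<And>y p. (norm p)\<^sup>2 / 2 - K0 \<le> H y p"
  obtains K where "K \<ge> 0"
    "\<And>p c v. cell_solution H \<Omega> p c v \<Longrightarrow> norm p \<le> K * (sqrt (2 * max 0 (c + K0)) + 1)"
proof -
  obtain a where a: "a \<in> \<Omega>" using \<Omega>(4) by blast
  have lat: "axis i 1 \<in> integer_lattice" for i :: 'n
    by (auto simp: integer_lattice_def axis_def)
  have a': "a + axis i 1 \<in> \<Omega>" for i using \<Omega>(3) a lat set_plus_intro by metis
  have "\<exists>K. \<forall>M w. M \<ge> 0 \<longrightarrow> continuous_on \<Omega> w \<longrightarrow>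
    viscosity_subsolution (\<lambda>_ _ q. norm q - M) \<Omega> w \<longrightarrow> \<bar>w (a + axis i 1) - w a\<bar> \<le> K * (M + 1)" for i
    using subsolution_increment_bound[OF \<Omega>(1,2) a' a] by metis
  then obtain K where K: "\<And>i M w. M \<ge> 0 \<Longrightarrow> continuous_on \<Omega> w \<Longrightarrow>
    viscosity_subsolution (\<lambda>_ _ q. norm q - M) \<Omega> w \<Longrightarrow> \<bar>w (a + axis i 1) - w a\<bar> \<le> K i * (M + 1)"
    by metis
  have bound: "norm p \<le> (\<Sum>i\<in>UNIV. \<bar>K i\<bar>) * (sqrt (2 * max 0 (c + K0)) + 1)"
    if sol: "cell_solution H \<Omega> p c v" for p c v
  proof -
    define M where "M = sqrt (2 * max 0 (c + K0))"
    define w where "w = (\<lambda>y. p \<bullet> y + v y)"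
    have "M \<ge> 0" by (simp add: M_def)
    have "continuous_on \<Omega> v"
      using sol unfolding cell_solution_def by (blast intro: continuous_on_subset[OF _ closure_subset])
    then have "continuous_on \<Omega> w" unfolding w_def by (intro continuous_intros)
    have sub: "viscosity_subsolution (\<lambda>y _ q. H y (p + q) - c) \<Omega> v"
      using sol by (simp add: cell_solution_def)
    have "viscosity_subsolution (\<lambda>_ _ q. norm q - M) \<Omega> w"
      unfolding viscosity_subsolution_def
    proof (intro allI impI)
      fix \<phi> x q
      assume \<phi>: "C1_function \<phi>" "x \<in> \<Omega>" "GDERIV \<phi> x :> q"
        and ev: "\<forall>\<^sub>F y in at x within \<Omega>. w y - \<phi> y \<le> w x - \<phi> x"
      \<comment> \<open>A test function for \<open>w\<close> becomes one for \<open>v\<close> when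
        the linear part is subtracted; the shift by \<open>p\<close> in the cell problem restores
        the gradient \<open>q\<close>.\<close>
      define \<psi> where "\<psi> = (\<lambda>y. \<phi> y - p \<bullet> y)"
      obtain D where D: "continuous_on UNIV D" "\<And>x. GDERIV \<phi> x :> D x"
        using \<phi>(1) by (auto simp: C1_function_def)
      have "C1_function \<psi>" unfolding \<psi>_def
        by (rule C1_functionI[OF GDERIV_diff[OF D(2) GDERIV_inner_right]])
          (intro continuous_intros D)
      moreover have "GDERIV \<psi> x :> q - p" unfolding \<psi>_def
        by (rule GDERIV_diff[OF \<phi>(3) GDERIV_inner_right])
      moreover have "\<forall>\<^sub>F y in at x within \<Omega>. v y - \<psi> y \<le> v x - \<psi> x"
        using ev by eventually_elim (simp add: w_def \<psi>_def)
      ultimately have "H x (p + (q - p)) - c \<le> 0"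
        using sub \<phi>(2) unfolding viscosity_subsolution_def by blast
      then have "(norm q)\<^sup>2 \<le> 2 * (c + K0)" using H_ge[of q x] by simp
      also have "\<dots> \<le> 2 * max 0 (c + K0)" by (intro mult_left_mono) auto
      finally have "(norm q)\<^sup>2 \<le> 2 * max 0 (c + K0)" .
      then show "norm q - M \<le> 0" unfolding M_def by (simp add: real_le_rsqrt)
    qed
    note inc = K[OF \<open>M \<ge> 0\<close> \<open>continuous_on \<Omega> w\<close> this]
    have "v (a + axis i 1) = v a" for i
      using sol a lat closure_subset[of \<Omega>] unfolding cell_solution_def by blast
    then have "w (a + axis i 1) - w a = p $ i" for i
      by (simp add: w_def inner_add_right inner_axis)
    with inc have "\<bar>p $ i\<bar> \<le> K i * (M + 1)" for i by metis
    then have "\<bar>p $ i\<bar> \<le> \<bar>K i\<bar> * (M + 1)" for i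
      using \<open>M \<ge> 0\<close> by (smt (verit) mult_right_mono)
    then have "(\<Sum>i\<in>UNIV. \<bar>p $ i\<bar>) \<le> (\<Sum>i\<in>UNIV. \<bar>K i\<bar> * (M + 1))" by (rule sum_mono)
    then show ?thesis using norm_le_l1_cart[of p] by (simp add: sum_distrib_right M_def)
  qed
  show thesis by (rule that[OF _ bound]) (simp add: sum_nonneg)
qed

section \<open>Convexity of the effective Hamiltonian\<close>

text \<open>The first two terms pull \<open>x1\<close> and \<open>x2\<close> towards the shifted
  point \<open>y + \<epsilon> *\<^sub>R e\<close> instead of \<open>y\<close>; the last one
  localizes \<open>y\<close> at \<open>z\<close>.\<close>

definition penalty :: "real \<Rightarrow> real \<Rightarrow> real \<Rightarrow> 'a::real_normed_vector \<Rightarrow> 'a \<Rightarrow> 'a \<Rightarrow> 'a \<Rightarrow> 'a \<Rightarrow> real" where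
  "penalty \<theta> \<mu> \<epsilon> e z x1 x2 y =
     \<theta> * (norm ((1 / \<epsilon>) *\<^sub>R (x1 - y) - e))\<^sup>2 + \<mu> * (norm ((1 / \<epsilon>) *\<^sub>R (x2 - y) - e))\<^sup>2 + (norm (y - z))\<^sup>2"

text \<open>The competitor with \<open>x1 = x2 = z + \<epsilon> *\<^sub>R e\<close> and
  \<open>y = z\<close> has zero penalty. Comparison with it first bounds the penalty crudely, which
  brings \<open>X1\<close> and \<open>X2\<close> close to \<open>Y\<close>; uniform continuity then
  makes the penalty small.\<close>

lemma penalized_maximum:
  fixes f1 f2 h :: "'a::euclidean_space \<Rightarrow> real"
  assumes N: "compact N" "z \<in> N"
    and cont: "continuous_on N f1" "continuous_on N f2" "continuous_on N h"
    and max: "\<And>x. x \<in> N \<Longrightarrow> \<theta> * f1 x + \<mu> * f2 x - h x \<le> \<theta> * f1 z + \<mu> * f2 z - h z"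
    and lm: "\<theta> > 0" "\<mu> > 0" "\<theta> + \<mu> = 1"
    and path: "\<epsilon>\<^sub>0 > 0" "\<And>\<epsilon>. 0 < \<epsilon> \<Longrightarrow> \<epsilon> < \<epsilon>\<^sub>0 \<Longrightarrow> z + \<epsilon> *\<^sub>R e \<in> N"
    and "\<kappa> > 0"
  obtains \<epsilon> X1 X2 Y where "0 < \<epsilon>" "\<epsilon> < \<kappa>" "X1 \<in> N" "X2 \<in> N" "Y \<in> N"
    "penalty \<theta> \<mu> \<epsilon> e z X1 X2 Y < \<kappa>"
    "\<And>x1 x2 y. x1 \<in> N \<Longrightarrow> x2 \<in> N \<Longrightarrow> y \<in> N \<Longrightarrow>
       \<theta> * f1 x1 + \<mu> * f2 x2 - h y - penalty \<theta> \<mu> \<epsilon> e z x1 x2 y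
       \<le> \<theta> * f1 X1 + \<mu> * f2 X2 - h Y - penalty \<theta> \<mu> \<epsilon> e z X1 X2 Y"
proof -
  have "bounded (f1 ` N)" "bounded (f2 ` N)" "bounded (h ` N)"
    using N cont by (auto intro!: compact_imp_bounded compact_continuous_image)
  then obtain W1 W2 W3 where W123: "\<And>x. x \<in> N \<Longrightarrow> \<bar>f1 x\<bar> \<le> W1" "\<And>x. x \<in> N \<Longrightarrow> \<bar>f2 x\<bar> \<le> W2"
      "\<And>x. x \<in> N \<Longrightarrow> \<bar>h x\<bar> \<le> W3"
    unfolding bounded_iff by (metis imageI real_norm_def)
  define W where "W = \<bar>W1\<bar> + \<bar>W2\<bar> + \<bar>W3\<bar>"
  have W: "\<bar>f1 x\<bar> \<le> W" "\<bar>f2 x\<bar> \<le> W" "\<bar>h x\<bar> \<le> W" if "x \<in> N" for x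
    using W123[OF that] by (auto simp: W_def)
  have comb: "\<bar>\<theta> * a + \<mu> * b\<bar> \<le> c" if "\<bar>a\<bar> \<le> c" "\<bar>b\<bar> \<le> c" for a b c
  proof -
    have "\<bar>\<theta> * a + \<mu> * b\<bar> \<le> \<theta> * \<bar>a\<bar> + \<mu> * \<bar>b\<bar>"
      using lm abs_triangle_ineq[of "\<theta> * a" "\<mu> * b"] by (simp add: abs_mult)
    also have "\<dots> \<le> \<theta> * c + \<mu> * c" using that lm by (intro add_mono mult_left_mono) auto
    also have "\<dots> = c" using lm by (simp add: distrib_right[symmetric])
    finally show ?thesis .
  qed
  have "uniformly_continuous_on N f1" "uniformly_continuous_on N f2"
    using N cont by (auto intro: compact_uniformly_continuous)
  moreover have "\<kappa> / 4 > 0" using \<open>\<kappa> > 0\<close> by simp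
  ultimately obtain d1 d2 where d12: "d1 > 0" "d2 > 0"
      "\<And>x y. x \<in> N \<Longrightarrow> y \<in> N \<Longrightarrow> dist y x < d1 \<Longrightarrow> dist (f1 y) (f1 x) < \<kappa> / 4"
      "\<And>x y. x \<in> N \<Longrightarrow> y \<in> N \<Longrightarrow> dist y x < d2 \<Longrightarrow> dist (f2 y) (f2 x) < \<kappa> / 4"
    by (metis uniformly_continuous_onE)
  define d where "d = min d1 d2"
  have d: "d > 0" "\<And>x y. x \<in> N \<Longrightarrow> y \<in> N \<Longrightarrow> dist y x < d \<Longrightarrow> \<bar>f1 y - f1 x\<bar> \<le> \<kappa> / 4"
      "\<And>x y. x \<in> N \<Longrightarrow> y \<in> N \<Longrightarrow> dist y x < d \<Longrightarrow> \<bar>f2 y - f2 x\<bar> \<le> \<kappa> / 4"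
    using d12 by (auto simp: d_def dist_real_def less_imp_le)
  \<comment> \<open>\<open>C\<close> bounds any vector whose weighted squared norm is at most
    \<open>4 * W\<close>; the summand 1 gives \<open>C \<le> C\<^sup>2\<close>.\<close>
  define C where "C = 4 * W / \<theta> + 4 * W / \<mu> + 1"
  have "W \<ge> 0" by (simp add: W_def)
  have C: "norm a \<le> C" if "\<theta> * (norm a)\<^sup>2 \<le> 4 * W \<or> \<mu> * (norm a)\<^sup>2 \<le> 4 * W" for a :: 'a
  proof -
    have "(norm a)\<^sup>2 \<le> 4 * W / \<theta> \<or> (norm a)\<^sup>2 \<le> 4 * W / \<mu>"
      using that lm by (simp add: pos_le_divide_eq mult.commute)
    moreover have "0 \<le> 4 * W / \<theta>" "0 \<le> 4 * W / \<mu>" using \<open>W \<ge> 0\<close> lm by auto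
    ultimately have "(norm a)\<^sup>2 \<le> C" "C \<ge> 1" unfolding C_def by linarith+
    moreover have "C * 1 \<le> C * C" using \<open>C \<ge> 1\<close> by (intro mult_left_mono) auto
    ultimately have "(norm a)\<^sup>2 \<le> C\<^sup>2" unfolding power2_eq_square by linarith
    then show ?thesis by (rule power2_le_imp_le) (use \<open>C \<ge> 1\<close> in simp)
  qed
  have "C \<ge> 1" using \<open>W \<ge> 0\<close> lm by (simp add: C_def)
  define \<epsilon> where "\<epsilon> = min (\<kappa> / 2) (min (\<epsilon>\<^sub>0 / 2) (d / (2 * (C + norm e))))"
  have Ce: "C + norm e > 0" using \<open>C \<ge> 1\<close> by (simp add: add_pos_nonneg)
  have \<epsilon>: "0 < \<epsilon>" "\<epsilon> < \<kappa>" "\<epsilon> < \<epsilon>\<^sub>0" using \<open>\<kappa> > 0\<close> path(1) d(1) Ce by (auto simp: \<epsilon>_def)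
  have "\<epsilon> * (C + norm e) \<le> d / (2 * (C + norm e)) * (C + norm e)"
    using Ce by (intro mult_right_mono) (auto simp: \<epsilon>_def)
  also have "\<dots> = d / 2" using Ce by (simp add: divide_simps)
  finally have \<epsilon>d: "\<epsilon> * (C + norm e) < d" using d(1) by simp
  define P where "P = penalty \<theta> \<mu> \<epsilon> e z"
  define \<Phi> where "\<Phi> = (\<lambda>(x1, x2, y). \<theta> * f1 x1 + \<mu> * f2 x2 - h y - P x1 x2 y)"
  have "compact (N \<times> N \<times> N)" using N by (intro compact_Times)
  moreover have "N \<times> N \<times> N \<noteq> {}" using N by auto
  moreover have "continuous_on (N \<times> N \<times> N) \<Phi>"
    unfolding \<Phi>_def P_def penalty_def split_beta
    by (intro continuous_intros continuous_on_compose2[OF cont(1)] continuous_on_compose2[OF cont(2)]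
        continuous_on_compose2[OF cont(3)]) auto
  ultimately obtain p where p: "p \<in> N \<times> N \<times> N" "\<And>q. q \<in> N \<times> N \<times> N \<Longrightarrow> \<Phi> q \<le> \<Phi> p"
    using continuous_attains_sup by metis
  obtain X1 X2 Y where pX: "p = (X1, X2, Y)" by (cases p) auto
  have X: "X1 \<in> N" "X2 \<in> N" "Y \<in> N" using p(1) pX by auto
  have opt: "\<theta> * f1 x1 + \<mu> * f2 x2 - h y - P x1 x2 y \<le> \<theta> * f1 X1 + \<mu> * f2 X2 - h Y - P X1 X2 Y"
    if "x1 \<in> N" "x2 \<in> N" "y \<in> N" for x1 x2 y
    using p(2)[of "(x1, x2, y)"] that unfolding pX \<Phi>_def by simp
  define z' where "z' = z + \<epsilon> *\<^sub>R e"
  have z': "z' \<in> N" using path \<epsilon> by (simp add: z'_def)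
  have "P z' z' z = 0" using \<epsilon> by (simp add: P_def penalty_def z'_def)
  with opt[OF z' z' N(2)]
  have ineq: "P X1 X2 Y \<le> (\<theta> * f1 X1 + \<mu> * f2 X2) - h Y - (\<theta> * f1 z' + \<mu> * f2 z') + h z" by simp
  define A1 A2 where "A1 = (1 / \<epsilon>) *\<^sub>R (X1 - Y) - e" and "A2 = (1 / \<epsilon>) *\<^sub>R (X2 - Y) - e"
  have PX: "P X1 X2 Y = \<theta> * (norm A1)\<^sup>2 + \<mu> * (norm A2)\<^sup>2 + (norm (Y - z))\<^sup>2"
    by (simp add: P_def penalty_def A1_def A2_def)
  have nn: "0 \<le> \<theta> * (norm A1)\<^sup>2" "0 \<le> \<mu> * (norm A2)\<^sup>2" "0 \<le> (norm (Y - z))\<^sup>2" using lm by auto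
  have "P X1 X2 Y \<le> 4 * W"
    using ineq comb[OF W(1)[OF X(1)] W(2)[OF X(2)]] comb[OF W(1)[OF z'] W(2)[OF z']]
      W(3)[OF X(3)] W(3)[OF N(2)] by linarith
  then have "\<theta> * (norm A1)\<^sup>2 \<le> 4 * W" "\<mu> * (norm A2)\<^sup>2 \<le> 4 * W" using nn PX by linarith+
  then have "norm A1 \<le> C" "norm A2 \<le> C" using C by blast+
  have near: "dist x Y < d" if "norm ((1 / \<epsilon>) *\<^sub>R (x - Y) - e) \<le> C" for x
  proof -
    have "norm (x - Y) = \<epsilon> * norm (((1 / \<epsilon>) *\<^sub>R (x - Y) - e) + e)" using \<epsilon> by simp
    also have "\<dots> \<le> \<epsilon> * (C + norm e)"
      using \<epsilon> that norm_triangle_ineq[of "(1 / \<epsilon>) *\<^sub>R (x - Y) - e" e]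
      by (intro mult_left_mono) linarith+
    finally show ?thesis using \<epsilon>d by (simp add: dist_norm)
  qed
  have "dist X1 Y < d" "dist X2 Y < d"
    using near \<open>norm A1 \<le> C\<close> \<open>norm A2 \<le> C\<close> by (auto simp: A1_def A2_def)
  then have 1: "\<bar>\<theta> * (f1 X1 - f1 Y) + \<mu> * (f2 X2 - f2 Y)\<bar> \<le> \<kappa> / 4"
    using d X by (intro comb) auto
  have "dist z' z < d"
  proof -
    have "\<epsilon> * norm e \<le> \<epsilon> * (C + norm e)" using \<epsilon> \<open>C \<ge> 1\<close> by (intro mult_left_mono) auto
    moreover have "dist z' z = \<epsilon> * norm e" using \<epsilon> by (simp add: z'_def dist_norm)
    ultimately show ?thesis using \<epsilon>d by linarith
  qed
  then have 2: "\<bar>\<theta> * (f1 z' - f1 z) + \<mu> * (f2 z' - f2 z)\<bar> \<le> \<kappa> / 4"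
    using d z' N by (intro comb) auto
  \<comment> \<open>Maximality of \<open>z\<close>, applied at \<open>Y\<close>, disposes of the
    values at \<open>Y\<close> and \<open>z\<close> and leaves two errors of at most
    \<open>\<kappa> / 4\<close>.\<close>
  have "P X1 X2 Y < \<kappa>"
    using ineq 1 2 max[OF X(3)] \<open>\<kappa> > 0\<close> unfolding right_diff_distrib by linarith
  with X \<epsilon> opt show thesis unfolding P_def by (intro that) auto
qed

text \<open>Soner's comparison argument: the shift by \<open>\<epsilon> e\<close> in the doubling pushes the
  points at which the subsolutions are tested into the open domain.  Doubling with both
  subsolutions at once spares a separate proof that convex combinations of subsolutions
  are subsolutions.\<close>
lemma cell_comparison_convex:
  fixes \<Omega> :: "(real^'n) set"
  assumes \<Omega>: "open \<Omega>" "\<Omega> + integer_lattice = \<Omega>" "\<Omega> \<noteq> {}" "C1_boundary \<Omega>"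
    and H_cont: "continuous_on UNIV (\<lambda>(y, p). H y p)"
    and H_convex: "\<And>y. convex_on UNIV (H y)"
    and H_ge: "\<And>y p. (norm p)\<^sup>2 / 2 - K0 \<le> H y p"
    and sol: "cell_solution H \<Omega> p1 c1 v1" "cell_solution H \<Omega> p2 c2 v2"
      "cell_solution H \<Omega> (\<theta> *\<^sub>R p1 + \<mu> *\<^sub>R p2) c v"
    and lm: "\<theta> > 0" "\<mu> > 0" "\<theta> + \<mu> = 1"
  shows "c \<le> \<theta> * c1 + \<mu> * c2"
proof (rule field_le_epsilon)
  fix \<eta> :: real assume "\<eta> > 0"
  have cont: "continuous_on (closure \<Omega>) v1" "continuous_on (closure \<Omega>) v2" "continuous_on (closure \<Omega>) v"
    and per: "\<And>y z. y \<in> closure \<Omega> \<Longrightarrow> z \<in> integer_lattice \<Longrightarrow> v1 (y + z) = v1 y"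
      "\<And>y z. y \<in> closure \<Omega> \<Longrightarrow> z \<in> integer_lattice \<Longrightarrow> v2 (y + z) = v2 y"
      "\<And>y z. y \<in> closure \<Omega> \<Longrightarrow> z \<in> integer_lattice \<Longrightarrow> v (y + z) = v y"
    and sub: "viscosity_subsolution (\<lambda>y _ q. H y (p1 + q) - c1) \<Omega> v1"
      "viscosity_subsolution (\<lambda>y _ q. H y (p2 + q) - c2) \<Omega> v2"
    and super: "viscosity_supersolution (\<lambda>y _ q. H y (\<theta> *\<^sub>R p1 + \<mu> *\<^sub>R p2 + q) - c) (closure \<Omega>) v"
    using sol unfolding cell_solution_def by auto
  \<comment> \<open>The minimum exists by periodicity; \<open>z\<close> may be a boundary
    point.\<close>
  obtain z where z: "z \<in> closure \<Omega>"
    and zmin: "\<And>x. x \<in> closure \<Omega> \<Longrightarrow> v z - (\<theta> * v1 z + \<mu> * v2 z) \<le> v x - (\<theta> * v1 x + \<mu> * v2 x)"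
  proof (rule periodic_attains_inf)
    show "continuous_on (closure \<Omega>) (\<lambda>x. v x - (\<theta> * v1 x + \<mu> * v2 x))"
      by (intro continuous_intros cont)
  qed (use \<Omega>(3) per lattice_shift_closure[OF \<Omega>(2)] in auto)
  obtain r \<delta> e where r: "r > 0" "\<delta> > 0" and cone: "\<And>y t. y \<in> closure \<Omega> \<Longrightarrow> y \<in> ball z r \<Longrightarrow>
      0 < t \<Longrightarrow> t < r \<Longrightarrow> ball (y + t *\<^sub>R e) (t * \<delta>) \<subseteq> \<Omega>"
    using C1_boundary_cone[OF \<Omega>(1,4) z] by blast
  define R where "R = r / 2"
  have R: "R > 0" "R < r" using r by (auto simp: R_def)
  define N where "N = closure \<Omega> \<inter> cball z R"
  have N: "compact N" "z \<in> N" unfolding N_def using z R by (auto intro: closed_Int_compact)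
  \<comment> \<open>The subsolution inequalities bound the momenta that they test, so uniform
    continuity of \<open>H\<close> is needed on a compact set only. The 1 in the radius of
    \<open>Q\<close> makes room for the derivative of the localizing term.\<close>
  define M where "M = sqrt (2 * (max c1 c2 + K0))"
  have M: "norm q \<le> M" if "H x q \<le> c1 \<or> H x q \<le> c2" for x q
  proof -
    have "H x q \<le> max c1 c2" using that by auto
    then have "(norm q)\<^sup>2 \<le> 2 * (max c1 c2 + K0)" using H_ge[of q x] by simp
    then show ?thesis unfolding M_def by (rule real_le_rsqrt)
  qed
  define Q where "Q = cball z R \<times> cball (0 :: real^'n) (M + 1)"
  have "compact Q" unfolding Q_def by (intro compact_Times compact_cball)
  then have "uniformly_continuous_on Q (\<lambda>(y, p). H y p)"
    using continuous_on_subset[OF H_cont] by (intro compact_uniformly_continuous) auto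
  then obtain d where d: "d > 0" and Hd': "\<And>a a'. a \<in> Q \<Longrightarrow> a' \<in> Q \<Longrightarrow> dist a' a < d \<Longrightarrow>
      dist (case a' of (y, p) \<Rightarrow> H y p) (case a of (y, p) \<Rightarrow> H y p) < \<eta> / 2"
    by (rule uniformly_continuous_onE[where \<epsilon> = "\<eta> / 2"]) (use \<open>\<eta> > 0\<close> in auto)
  have Hd: "dist (H y' p') (H y p) < \<eta> / 2"
    if "(y, p) \<in> Q" "(y', p') \<in> Q" "dist (y', p') (y, p) < d" for y p y' p'
    using Hd'[OF that] by simp
  define \<rho> where "\<rho> = min (min (R / 2) (1 / 2)) (d / 4)"
  have \<rho>: "0 < \<rho>" "\<rho> < R" "2 * \<rho> \<le> 1" "2 * \<rho> < d" using R d by (auto simp: \<rho>_def)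
  \<comment> \<open>The entries serve in turn to keep \<open>Y\<close> within \<rho> of
    \<open>z\<close>, to place \<open>X1\<close> and \<open>X2\<close> in the interior cone at
    \<open>Y\<close>, and to make \<epsilon> so small that the cone condition applies and that
    \<open>X1\<close> and \<open>X2\<close> are within \<rho> of \<open>Y\<close>.\<close>
  define \<kappa> where "\<kappa> = min (min (\<rho>\<^sup>2) (min (\<theta> * \<delta>\<^sup>2) (\<mu> * \<delta>\<^sup>2))) (min r (\<rho> / (norm e + \<delta> + 1)) / 2)"
  have e1: "norm e + \<delta> + 1 > 0" using r by (simp add: add_nonneg_pos)
  have "\<kappa> > 0" using \<rho> lm r e1 by (simp add: \<kappa>_def)
  define \<epsilon>\<^sub>0 where "\<epsilon>\<^sub>0 = min r (R / (norm e + 1))"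
  have e2: "norm e + 1 > 0" by (simp add: add_nonneg_pos)
  have "\<epsilon>\<^sub>0 > 0" using r R e2 by (simp add: \<epsilon>\<^sub>0_def)
  moreover have "z + \<epsilon> *\<^sub>R e \<in> N" if "0 < \<epsilon>" "\<epsilon> < \<epsilon>\<^sub>0" for \<epsilon>
  proof -
    have "z + \<epsilon> *\<^sub>R e \<in> ball (z + \<epsilon> *\<^sub>R e) (\<epsilon> * \<delta>)" using that r by simp
    then have "z + \<epsilon> *\<^sub>R e \<in> \<Omega>" using cone[OF z, of \<epsilon>] r that by (auto simp: \<epsilon>\<^sub>0_def)
    moreover have "\<epsilon> * norm e \<le> R"
    proof -
      have "\<epsilon> * norm e \<le> \<epsilon> * (norm e + 1)" using that by simp
      also have "\<dots> < R" using that e2 by (simp add: \<epsilon>\<^sub>0_def pos_less_divide_eq)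
      finally show ?thesis by simp
    qed
    ultimately show ?thesis using that closure_subset[of \<Omega>] by (auto simp: N_def dist_norm)
  qed
  moreover have "continuous_on N v1" "continuous_on N v2" "continuous_on N v"
    using cont by (auto simp: N_def intro: continuous_on_subset)
  moreover have "\<theta> * v1 x + \<mu> * v2 x - v x \<le> \<theta> * v1 z + \<mu> * v2 z - v z" if "x \<in> N" for x
    using zmin[of x] that by (simp add: N_def)
  ultimately obtain \<epsilon> X1 X2 Y where \<epsilon>: "0 < \<epsilon>" "\<epsilon> < \<kappa>" and X: "X1 \<in> N" "X2 \<in> N" "Y \<in> N"
    and pen: "penalty \<theta> \<mu> \<epsilon> e z X1 X2 Y < \<kappa>"
    and opt: "\<And>x1 x2 y. x1 \<in> N \<Longrightarrow> x2 \<in> N \<Longrightarrow> y \<in> N \<Longrightarrow>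
       \<theta> * v1 x1 + \<mu> * v2 x2 - v y - penalty \<theta> \<mu> \<epsilon> e z x1 x2 y
       \<le> \<theta> * v1 X1 + \<mu> * v2 X2 - v Y - penalty \<theta> \<mu> \<epsilon> e z X1 X2 Y"
    using penalized_maximum[OF N, of v1 v2 v \<theta> \<mu> \<epsilon>\<^sub>0 e \<kappa>] lm \<open>\<kappa> > 0\<close> by blast
  define A1 A2 where "A1 = (1 / \<epsilon>) *\<^sub>R (X1 - Y) - e" and "A2 = (1 / \<epsilon>) *\<^sub>R (X2 - Y) - e"
  have pen': "\<theta> * (norm A1)\<^sup>2 + \<mu> * (norm A2)\<^sup>2 + (norm (Y - z))\<^sup>2 < \<kappa>"
    using pen by (simp add: penalty_def A1_def A2_def)
  have nn: "0 \<le> \<theta> * (norm A1)\<^sup>2" "0 \<le> \<mu> * (norm A2)\<^sup>2" "0 \<le> (norm (Y - z))\<^sup>2" using lm by auto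
  have "\<theta> * (norm A1)\<^sup>2 < \<theta> * \<delta>\<^sup>2" "\<mu> * (norm A2)\<^sup>2 < \<mu> * \<delta>\<^sup>2" "(norm (Y - z))\<^sup>2 < \<rho>\<^sup>2"
    using pen' nn unfolding \<kappa>_def by linarith+
  then have A: "norm A1 < \<delta>" "norm A2 < \<delta>" and Yz: "norm (Y - z) < \<rho>"
    using lm r \<rho> by (auto intro: power2_less_imp_less)
  have \<epsilon>r: "\<epsilon> < r" using \<epsilon> r \<rho> by (simp add: \<kappa>_def)
  have "\<rho> / (norm e + \<delta> + 1) > 0" using \<rho> e1 by simp
  then have "\<epsilon> < \<rho> / (norm e + \<delta> + 1)"
    using \<epsilon> \<open>\<rho> / (norm e + \<delta> + 1) > 0\<close> by (simp add: \<kappa>_def)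
  then have \<epsilon>\<rho>: "\<epsilon> * (norm e + \<delta> + 1) < \<rho>" using e1 by (simp add: pos_less_divide_eq)
  have Y: "Y \<in> closure \<Omega>" "Y \<in> ball z r"
    using X(3) R by (auto simp: N_def dist_norm)
  \<comment> \<open>A rescaled offset shorter than \<delta> puts \<open>x\<close> in the ball of
    radius \<open>\<epsilon> * \<delta>\<close> about \<open>Y + \<epsilon> *\<^sub>R e\<close>,
    which lies in \<Omega> by the cone condition.\<close>
  have inside: "x \<in> \<Omega> \<and> dist x Y < \<rho>" if "norm ((1 / \<epsilon>) *\<^sub>R (x - Y) - e) < \<delta>" for x
  proof -
    define a where "a = (1 / \<epsilon>) *\<^sub>R (x - Y) - e"
    have x: "x - Y = \<epsilon> *\<^sub>R (a + e)" using \<epsilon> by (simp add: a_def)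
    have "x = Y + \<epsilon> *\<^sub>R e + \<epsilon> *\<^sub>R a" using x by (simp add: algebra_simps)
    then have "dist (Y + \<epsilon> *\<^sub>R e) x = \<epsilon> * norm a" using \<epsilon> by (simp add: dist_norm)
    also have "\<dots> < \<epsilon> * \<delta>" using that \<epsilon> by (simp add: a_def)
    finally have "x \<in> \<Omega>" using cone[OF Y \<epsilon>(1) \<epsilon>r] by auto
    moreover have "norm (x - Y) \<le> \<epsilon> * (norm e + \<delta> + 1)"
    proof -
      have "norm (x - Y) = \<epsilon> * norm (a + e)" using \<epsilon> by (simp add: x)
      also have "\<dots> \<le> \<epsilon> * (norm e + \<delta> + 1)"
        using \<epsilon> that norm_triangle_ineq[of a e] unfolding a_def[symmetric]
        by (intro mult_left_mono) linarith+
      finally show ?thesis .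
    qed
    ultimately show ?thesis using \<epsilon>\<rho> by (simp add: dist_norm)
  qed
  have X1: "X1 \<in> \<Omega>" "dist X1 Y < \<rho>" and X2: "X2 \<in> \<Omega>" "dist X2 Y < \<rho>"
    using inside A by (auto simp: A1_def A2_def)
  have Xz: "dist x z < R" if "dist x Y < \<rho>" for x
    using that Yz \<rho> dist_triangle[of x z Y] by (simp add: \<rho>_def dist_norm)
  have nbhd: "x \<in> N" if "x \<in> closure \<Omega>" "dist x X < R - dist X z" for x X
    using that dist_triangle[of x z X] by (auto simp: N_def dist_commute)
  define P1 P2 where "P1 = (2 * (1 / \<epsilon>)) *\<^sub>R A1" and "P2 = (2 * (1 / \<epsilon>)) *\<^sub>R A2"
  have C1: "C1_function (\<lambda>x. (norm ((1 / \<epsilon>) *\<^sub>R (x - Y) - e))\<^sup>2)"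
    by (rule C1_functionI[OF GDERIV_power2_norm_scaled]) (intro continuous_intros)
  \<comment> \<open>With \<open>X2\<close> and \<open>Y\<close> frozen, division by the weight
    \<theta> shows that \<open>X1\<close> is a local maximum of \<open>v1\<close> minus a quadratic.
    It lies in the open domain, so the subsolution property applies.\<close>
  have H1: "H X1 (p1 + P1) - c1 \<le> 0"
  proof (rule viscosity_subsolutionD[OF sub(1) C1 X1(1)])
    show "GDERIV (\<lambda>x. (norm ((1 / \<epsilon>) *\<^sub>R (x - Y) - e))\<^sup>2) X1 :> P1"
      unfolding P1_def A1_def by (rule GDERIV_power2_norm_scaled)
    show "0 < R - dist X1 z" using Xz[OF X1(2)] by simp
    fix x assume "x \<in> \<Omega>" "dist x X1 < R - dist X1 z"
    then have "x \<in> N" using nbhd closure_subset[of \<Omega>] by auto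
    from opt[OF this X(2,3)] have "\<theta> * (v1 x - (norm ((1 / \<epsilon>) *\<^sub>R (x - Y) - e))\<^sup>2) \<le>
        \<theta> * (v1 X1 - (norm ((1 / \<epsilon>) *\<^sub>R (X1 - Y) - e))\<^sup>2)"
      by (simp add: penalty_def right_diff_distrib)
    then show "v1 x - (norm ((1 / \<epsilon>) *\<^sub>R (x - Y) - e))\<^sup>2 \<le> v1 X1 - (norm ((1 / \<epsilon>) *\<^sub>R (X1 - Y) - e))\<^sup>2"
      using lm by simp
  qed
  have H2: "H X2 (p2 + P2) - c2 \<le> 0"
  proof (rule viscosity_subsolutionD[OF sub(2) C1 X2(1)])
    show "GDERIV (\<lambda>x. (norm ((1 / \<epsilon>) *\<^sub>R (x - Y) - e))\<^sup>2) X2 :> P2"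
      unfolding P2_def A2_def by (rule GDERIV_power2_norm_scaled)
    show "0 < R - dist X2 z" using Xz[OF X2(2)] by simp
    fix x assume "x \<in> \<Omega>" "dist x X2 < R - dist X2 z"
    then have "x \<in> N" using nbhd closure_subset[of \<Omega>] by auto
    from opt[OF X(1) this X(3)] have "\<mu> * (v2 x - (norm ((1 / \<epsilon>) *\<^sub>R (x - Y) - e))\<^sup>2) \<le>
        \<mu> * (v2 X2 - (norm ((1 / \<epsilon>) *\<^sub>R (X2 - Y) - e))\<^sup>2)"
      by (simp add: penalty_def right_diff_distrib)
    then show "v2 x - (norm ((1 / \<epsilon>) *\<^sub>R (x - Y) - e))\<^sup>2 \<le> v2 X2 - (norm ((1 / \<epsilon>) *\<^sub>R (X2 - Y) - e))\<^sup>2"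
      using lm by simp
  qed
  \<comment> \<open>With \<open>X1\<close> and \<open>X2\<close> frozen, \<open>Y\<close> minimizes
    \<open>v\<close> plus the penalty. \<open>Y\<close> may lie on the boundary, where the
    supersolution property is still available.\<close>
  define \<phi> where "\<phi> = (\<lambda>y. - penalty \<theta> \<mu> \<epsilon> e z X1 X2 y)"
  define D where "D = (\<lambda>y. \<theta> *\<^sub>R ((2 * (1 / \<epsilon>)) *\<^sub>R ((1 / \<epsilon>) *\<^sub>R (X1 - y) - e)) +
      \<mu> *\<^sub>R ((2 * (1 / \<epsilon>)) *\<^sub>R ((1 / \<epsilon>) *\<^sub>R (X2 - y) - e)) - 2 *\<^sub>R (y - z))"
  have \<phi>D: "GDERIV \<phi> y :> D y" for y
    unfolding \<phi>_def D_def penalty_def gderiv_def power2_norm_eq_inner using \<epsilon>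
    by (auto intro!: derivative_eq_intros simp: inner_commute algebra_simps)
  have "H Y (\<theta> *\<^sub>R p1 + \<mu> *\<^sub>R p2 + D Y) - c \<ge> 0"
  proof (rule viscosity_supersolutionD[OF super _ Y(1) \<phi>D])
    show "C1_function \<phi>" by (rule C1_functionI[OF \<phi>D]) (auto simp: D_def intro!: continuous_intros)
    show "0 < R - dist Y z" using Yz \<rho> by (simp add: dist_norm)
    fix y assume "y \<in> closure \<Omega>" "dist y Y < R - dist Y z"
    then have "y \<in> N" using nbhd by auto
    from opt[OF X(1,2) this] show "v y - \<phi> y \<ge> v Y - \<phi> Y" by (simp add: \<phi>_def)
  qed
  moreover define q1 q2 where "q1 = p1 + P1" and "q2 = p2 + P2"
  define q where "q = \<theta> *\<^sub>R q1 + \<mu> *\<^sub>R q2"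
  \<comment> \<open>The quadratics have opposite gradients in \<open>x1\<close>, \<open>x2\<close>
    and in \<open>y\<close>, so the momentum at \<open>Y\<close> is the convex combination of the
    two tested momenta, up to the localizing term.\<close>
  have "\<theta> *\<^sub>R p1 + \<mu> *\<^sub>R p2 + D Y = q - 2 *\<^sub>R (Y - z)"
    by (simp add: q_def q1_def q2_def D_def P1_def P2_def A1_def A2_def algebra_simps)
  ultimately have HY: "c \<le> H Y (q - 2 *\<^sub>R (Y - z))" by simp
  have q1: "norm q1 \<le> M" and q2: "norm q2 \<le> M" using M H1 H2 by (auto simp: q1_def q2_def)
  have "norm q \<le> \<theta> * norm q1 + \<mu> * norm q2"
    unfolding q_def using lm norm_triangle_ineq[of "\<theta> *\<^sub>R q1" "\<mu> *\<^sub>R q2"] by simp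
  also have "\<dots> \<le> \<theta> * M + \<mu> * M" using lm q1 q2 by (intro add_mono mult_left_mono) auto
  also have "\<dots> = M" using lm by (simp add: distrib_right[symmetric])
  finally have q: "norm q \<le> M" .
  have inQ: "(x, p) \<in> Q" if "x \<in> N" "norm p \<le> M + 1" for x p
    using that by (simp add: Q_def N_def)
  have "norm (q - 2 *\<^sub>R (Y - z)) \<le> M + 1"
    using q Yz \<rho> norm_triangle_ineq4[of q "2 *\<^sub>R (Y - z)"] by simp
  then have "dist (H Y (q - 2 *\<^sub>R (Y - z))) (H Y q) < \<eta> / 2"
    using X q Yz \<rho> by (intro Hd inQ) (auto simp: dist_Pair_Pair dist_norm)
  moreover have "dist Y X1 < d" "dist Y X2 < d" using X1(2) X2(2) \<rho> by (simp_all add: dist_commute)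
  then have "dist (H Y q1) (H X1 q1) < \<eta> / 2" "dist (H Y q2) (H X2 q2) < \<eta> / 2"
    using X q1 q2 by (intro Hd inQ; simp add: dist_Pair_Pair)+
  then have "H Y q1 \<le> c1 + \<eta> / 2" "H Y q2 \<le> c2 + \<eta> / 2"
    using H1 H2 unfolding dist_real_def q1_def[symmetric] q2_def[symmetric] by linarith+
  \<comment> \<open>Both momenta are now evaluated at the common point \<open>Y\<close>, where
    convexity of \<open>H Y\<close> applies. As the weights sum to 1, the error here is
    \<open>\<eta> / 2\<close>; the localizing term accounts for the other half.\<close>
  then have "\<theta> * H Y q1 + \<mu> * H Y q2 \<le> \<theta> * (c1 + \<eta> / 2) + \<mu> * (c2 + \<eta> / 2)"
    using lm by (intro add_mono mult_left_mono) auto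
  moreover have "\<theta> * (c1 + \<eta> / 2) + \<mu> * (c2 + \<eta> / 2) = \<theta> * c1 + \<mu> * c2 + (\<theta> + \<mu>) * (\<eta> / 2)"
    by (simp add: algebra_simps)
  moreover have "H Y q \<le> \<theta> * H Y q1 + \<mu> * H Y q2"
    using H_convex[of Y] lm unfolding q_def convex_on_def by auto
  ultimately show "c \<le> \<theta> * c1 + \<mu> * c2 + \<eta>" using HY unfolding dist_real_def lm(3) by linarith
qed

text \<open>The minimum of the corrector may lie on the boundary; the state-constraint supersolution
  property allows a constant test function there too.\<close>

lemma cell_constant_le:
  fixes \<Omega> :: "(real^'n) set"
  assumes \<Omega>: "\<Omega> + integer_lattice = \<Omega>" "\<Omega> \<noteq> {}"
    and sol: "cell_solution H \<Omega> p c v"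
  obtains y where "c \<le> H y p"
proof -
  obtain y where y: "y \<in> closure \<Omega>" "\<And>x. x \<in> closure \<Omega> \<Longrightarrow> v y \<le> v x"
    using sol \<Omega> lattice_shift_closure[OF \<Omega>(1)]
    by (auto simp: cell_solution_def elim!: periodic_attains_inf[rotated 3])
  have "viscosity_supersolution (\<lambda>y _ q. H y (p + q) - c) (closure \<Omega>) v"
    using sol by (simp add: cell_solution_def)
  then have "H y (p + 0) - c \<ge> 0"
  proof (rule viscosity_supersolutionD[where \<phi> = "\<lambda>_. 0" and r = 1])
    show "C1_function (\<lambda>_::real^'n. 0)" by (rule C1_functionI[OF GDERIV_const]) simp
    show "GDERIV (\<lambda>_. 0) y :> 0" by (rule GDERIV_const)
  qed (use y in auto)
  then show thesis using that by simp
qed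

section \<open>The value function of the optimal stopping problem\<close>

lemma GDERIV_error:
  assumes "GDERIV \<phi> x :> q" "\<epsilon> > 0"
  obtains d where "d > 0" "\<And>z. norm z < d \<Longrightarrow> \<bar>\<phi> (x + z) - \<phi> x - z \<bullet> q\<bar> \<le> \<epsilon> * norm z"
proof -
  obtain d where "d > 0" and
    d: "\<And>y. norm (y - x) < d \<Longrightarrow> norm (\<phi> y - \<phi> x - (y - x) \<bullet> q) \<le> \<epsilon> * norm (y - x)"
    using assms unfolding gderiv_def has_derivative_at_alt by metis
  show thesis using d[of "x + z" for z] \<open>d > 0\<close> by (intro that[of d]) auto
qed

text \<open>This lets two successive straight segments, of durations \<open>h\<close> and
  \<open>r\<close>, be replaced by a single one at no greater cost.\<close>

lemma convex_on_perspective: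
  fixes L :: "'a::real_vector \<Rightarrow> real"
  assumes L: "convex_on UNIV L" and "h > 0" "r > 0"
  shows "(h + r) * L ((h *\<^sub>R v + r *\<^sub>R w) /\<^sub>R (h + r)) \<le> h * L v + r * L w"
proof -
  have "L ((h / (h + r)) *\<^sub>R v + (r / (h + r)) *\<^sub>R w) \<le> h / (h + r) * L v + r / (h + r) * L w"
  proof -
    have "1 - r / (h + r) = h / (h + r)" using assms by (simp add: field_simps)
    then show ?thesis using convex_onD[OF L, of "r / (h + r)" v w] assms by simp
  qed
  also have "(h / (h + r)) *\<^sub>R v + (r / (h + r)) *\<^sub>R w = (h *\<^sub>R v + r *\<^sub>R w) /\<^sub>R (h + r)"
    by (simp add: scaleR_add_right divide_inverse mult.commute)
  finally have "L ((h *\<^sub>R v + r *\<^sub>R w) /\<^sub>R (h + r)) \<le> (h * L v + r * L w) / (h + r)"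
    by (simp add: add_divide_distrib)
  then show ?thesis using assms by (simp add: pos_le_divide_eq mult.commute)
qed

text \<open>Fenchel's inequality and its equality case are all that ties \<open>L\<close> to
  \<open>H\<close>: equality for some velocity yields the subsolution property, the inequality the
  supersolution property.\<close>

locale hopf_lax =
  fixes L H :: "real^'n \<Rightarrow> real" and g \<beta> :: "real^'n \<Rightarrow> real" and K B \<Lambda> :: real
  assumes L_convex: "convex_on UNIV L"
    and K_nonneg: "K \<ge> 0"
    and L_ge: "\<And>v. (norm v)\<^sup>2 / 2 - K \<le> L v"
    and fenchel: "\<And>q v. q \<bullet> v - H q \<le> L v"
    and fenchel_attained: "\<And>q. \<exists>v. H q \<le> q \<bullet> v - L v"
    and g_lipschitz: "\<Lambda>-lipschitz_on UNIV g"
    and g_le: "\<And>x. g x \<le> \<beta> x"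
    and g_bound: "\<And>x. \<bar>g x\<bar> \<le> B"
    and \<beta>_bound: "\<And>x. \<bar>\<beta> x\<bar> \<le> B"
    and \<beta>_uc: "uniformly_continuous_on UNIV \<beta>"
begin

definition cost :: "real^'n \<Rightarrow> real \<Rightarrow> real \<Rightarrow> real^'n \<Rightarrow> real" where
  "cost x t \<tau> y = (t - \<tau>) * L ((x - y) /\<^sub>R (t - \<tau>)) + stopping_cost g \<beta> y \<tau>"

definition val :: "real^'n \<Rightarrow> real \<Rightarrow> real" where
  "val x t = (if t > 0 then INF (\<tau>, y) \<in> {0..<t} \<times> UNIV. cost x t \<tau> y else g x)"

section \<open>Bounds on the cost, dynamic programming and regularity of the value\<close>

lemma stopping_cost_bounds:
  "g y \<le> stopping_cost g \<beta> y \<tau>" "stopping_cost g \<beta> y \<tau> \<le> \<beta> y" "- B \<le> stopping_cost g \<beta> y \<tau>"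
  using g_le[of y] g_bound[of y] \<beta>_bound[of y] by (auto simp: stopping_cost_def)

lemma B_nonneg: "B \<ge> 0"
  using g_bound[of 0] by simp

lemma cost_ge_norm:
  assumes "\<tau> < t"
  shows "(norm (x - y))\<^sup>2 / (2 * (t - \<tau>)) - K * (t - \<tau>) + stopping_cost g \<beta> y \<tau> \<le> cost x t \<tau> y"
proof -
  have n: "norm ((x - y) /\<^sub>R (t - \<tau>)) = norm (x - y) / (t - \<tau>)"
    using assms by (simp add: divide_inverse mult.commute)
  have "(t - \<tau>) * ((norm ((x - y) /\<^sub>R (t - \<tau>)))\<^sup>2 / 2 - K) \<le> (t - \<tau>) * L ((x - y) /\<^sub>R (t - \<tau>))"
    using assms L_ge by (intro mult_left_mono L_ge) simp
  also have "(t - \<tau>) * ((norm ((x - y) /\<^sub>R (t - \<tau>)))\<^sup>2 / 2 - K) =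
      (norm (x - y))\<^sup>2 / (2 * (t - \<tau>)) - K * (t - \<tau>)"
    unfolding n using assms by (simp add: power2_eq_square divide_simps) (simp add: algebra_simps)
  finally show ?thesis by (simp add: cost_def)
qed

lemma cost_ge:
  assumes "0 \<le> \<tau>" "\<tau> < t"
  shows "- K * t - B \<le> cost x t \<tau> y"
proof -
  have "0 \<le> (norm (x - y))\<^sup>2 / (2 * (t - \<tau>))" using assms by simp
  moreover have "K * (t - \<tau>) \<le> K * t" using assms K_nonneg by (intro mult_left_mono) auto
  ultimately show ?thesis
    using cost_ge_norm[OF assms(2), of x y] stopping_cost_bounds(3)[of y \<tau>] by simp
qed

lemma val_0: "val x 0 = g x"
  by (simp add: val_def)

lemma val_le_cost:
  assumes "0 \<le> \<tau>" "\<tau> < t"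
  shows "val x t \<le> cost x t \<tau> y"
proof -
  have "bdd_below ((\<lambda>(\<tau>, y). cost x t \<tau> y) ` ({0..<t} \<times> UNIV))"
    using cost_ge by (intro bdd_belowI2[of _ "- K * t - B"]) auto
  then have "(INF (\<tau>, y) \<in> {0..<t} \<times> UNIV. cost x t \<tau> y) \<le> (case (\<tau>, y) of (\<tau>, y) \<Rightarrow> cost x t \<tau> y)"
    using assms by (intro cINF_lower) auto
  then show ?thesis using assms by (simp add: val_def)
qed

lemma le_valI:
  assumes "t > 0" "\<And>\<tau> y. 0 \<le> \<tau> \<Longrightarrow> \<tau> < t \<Longrightarrow> c \<le> cost x t \<tau> y"
  shows "c \<le> val x t"
proof -
  have "c \<le> (INF (\<tau>, y) \<in> {0..<t} \<times> UNIV. cost x t \<tau> y)"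
    using assms by (intro cINF_greatest) auto
  then show ?thesis using assms by (simp add: val_def)
qed

lemma val_near_minimizer:
  assumes "t > 0" "\<epsilon> > 0"
  obtains \<tau> y where "0 \<le> \<tau>" "\<tau> < t" "cost x t \<tau> y < val x t + \<epsilon>"
  using le_valI[OF assms(1), of "val x t + \<epsilon>" x] assms(2) by (meson add_le_same_cancel1 not_le)

lemma val_le_terminal:
  assumes "t \<ge> 0"
  shows "val x t \<le> t * L v + g (x - t *\<^sub>R v)"
proof (cases "t = 0")
  case False
  then show ?thesis
    using assms val_le_cost[of 0 t x "x - t *\<^sub>R v"] by (simp add: cost_def stopping_cost_def)
qed (simp add: val_0)

text \<open>One half of dynamic programming: by convexity of \<open>L\<close>, moving with velocity
  \<open>v\<close> for time \<open>h\<close> and then along another line is no better than the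
  direct line. At \<open>h = t\<close> no time remains, and \<open>val\<close> is not given by an
  infimum there.\<close>

lemma val_step:
  assumes "0 < h" "h \<le> t"
  shows "val x t \<le> h * L v + val (x - h *\<^sub>R v) (t - h)"
proof (cases "h = t")
  case True
  then show ?thesis using val_le_terminal[of t x v] assms by (simp add: val_0)
next
  case False
  with assms have "t - h > 0" by simp
  then have "val x t - h * L v \<le> val (x - h *\<^sub>R v) (t - h)"
  proof (rule le_valI)
    fix \<tau> y assume \<tau>: "0 \<le> \<tau>" "\<tau> < t - h"
    define r where "r = t - h - \<tau>"
    have r: "r > 0" "t - \<tau> = h + r" "t - h - \<tau> = r" using \<tau> by (auto simp: r_def)
    have "h *\<^sub>R v + r *\<^sub>R ((x - h *\<^sub>R v - y) /\<^sub>R r) = x - y" using r by simp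
    with convex_on_perspective[OF L_convex assms(1) r(1), of v "(x - h *\<^sub>R v - y) /\<^sub>R r"]
    have "cost x t \<tau> y \<le> h * L v + cost (x - h *\<^sub>R v) (t - h) \<tau> y"
      unfolding cost_def r(2,3) by simp
    moreover have "val x t \<le> cost x t \<tau> y" using \<tau> assms by (intro val_le_cost) auto
    ultimately show "val x t - h * L v \<le> cost (x - h *\<^sub>R v) (t - h) \<tau> y" by simp
  qed
  then show ?thesis by simp
qed

text \<open>Immediate stopping is excluded by \<open>\<tau> < t\<close>, so it is approximated by
  resting at \<open>x\<close> for a short time.\<close>

lemma val_le_obstacle:
  assumes "t > 0"
  shows "val x t \<le> \<beta> x"
proof (rule field_le_epsilon)
  fix e :: real assume "e > 0"
  define s where "s = min (t / 2) (e / (\<bar>L 0\<bar> + 1))"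
  have s: "0 < s" "s < t" using assms \<open>e > 0\<close> by (auto simp: s_def)
  have "s * L 0 \<le> s * (\<bar>L 0\<bar> + 1)" using s by (intro mult_left_mono) auto
  also have "\<dots> \<le> e / (\<bar>L 0\<bar> + 1) * (\<bar>L 0\<bar> + 1)" by (intro mult_right_mono) (auto simp: s_def)
  also have "\<dots> = e" by (simp add: add_nonneg_eq_0_iff)
  finally have "s * L 0 \<le> e" .
  moreover have "val x t \<le> s * L 0 + \<beta> x"
    using val_le_cost[of "t - s" t x x] s by (simp add: cost_def stopping_cost_def)
  ultimately show "val x t \<le> \<beta> x + e" by simp
qed

text \<open>A competitor for time \<open>t + h\<close> is turned into one for time \<open>t\<close>:
  by translation in time or, if its stopping time is below \<open>h\<close>, by cutting off the
  piece that ends at \<open>y\<close>.\<close>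

lemma val_time_lower:
  assumes "t \<ge> 0" "h > 0"
  shows "val x t \<le> val x (t + h) + (K + \<Lambda>\<^sup>2 / 2) * h"
proof -
  have M: "0 \<le> K + \<Lambda>\<^sup>2 / 2" using K_nonneg by simp
  have "val x t - (K + \<Lambda>\<^sup>2 / 2) * h \<le> val x (t + h)"
  proof (rule le_valI)
    fix \<tau> y assume \<tau>: "0 \<le> \<tau>" "\<tau> < t + h"
    show "val x t - (K + \<Lambda>\<^sup>2 / 2) * h \<le> cost x (t + h) \<tau> y"
    proof (cases "h \<le> \<tau>")
      case True
      \<comment> \<open>If \<open>\<tau> = h\<close>, the translated competitor stops at time 0 and
        pays \<open>g\<close> instead of \<open>\<beta>\<close>, which is no worse since
        \<open>g \<le> \<beta>\<close>.\<close>
      have "val x t \<le> cost x t (\<tau> - h) y" using True \<tau> by (intro val_le_cost) auto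
      also have "\<dots> \<le> cost x (t + h) \<tau> y"
        using stopping_cost_bounds(2)[of y "\<tau> - h"] True assms
        by (simp add: cost_def stopping_cost_def algebra_simps)
      finally show ?thesis using M assms by (smt (verit) mult_nonneg_nonneg)
    next
      case False
      define k where "k = h - \<tau>"
      have k: "0 < k" "k \<le> h" "t + h - \<tau> = t + k" using False \<tau> by (auto simp: k_def)
      define v where "v = (x - y) /\<^sub>R (t + k)"
      have "(t + k) *\<^sub>R v = x - y" using k assms by (simp add: v_def)
      then have xt: "x - t *\<^sub>R v = y + k *\<^sub>R v" by (simp add: algebra_simps)
      have "val x t \<le> t * L v + g (y + k *\<^sub>R v)" using val_le_terminal[of t x v] assms xt by simp
      moreover have "\<bar>g (y + k *\<^sub>R v) - g y\<bar> \<le> \<Lambda> * (k * norm v)"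
        using lipschitz_onD[OF g_lipschitz, of "y + k *\<^sub>R v" y] k by (simp add: dist_norm)
      moreover have "k * ((norm v)\<^sup>2 / 2 - K) \<le> k * L v" using L_ge k by (intro mult_left_mono) auto
      \<comment> \<open>The cut saves at least \<open>k * ((norm v)\<^sup>2 / 2 - K)\<close>, while
        the Lipschitz bound on \<open>g\<close> charges \<open>\<Lambda> * (k * norm v)\<close>.
        Completing the square bounds the net loss independently of \<open>v\<close>.\<close>
      moreover have "k * ((norm v)\<^sup>2 / 2 - K) - \<Lambda> * (k * norm v) =
          k * ((norm v - \<Lambda>)\<^sup>2 / 2) - (K + \<Lambda>\<^sup>2 / 2) * k"
        by (simp add: power2_eq_square field_simps)
      moreover have "0 \<le> k * ((norm v - \<Lambda>)\<^sup>2 / 2)" using k by simp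
      moreover have "(K + \<Lambda>\<^sup>2 / 2) * k \<le> (K + \<Lambda>\<^sup>2 / 2) * h" using k M by (intro mult_left_mono)
      moreover have "cost x (t + h) \<tau> y = t * L v + k * L v + stopping_cost g \<beta> y \<tau>"
        unfolding cost_def k(3) v_def by (simp add: algebra_simps)
      ultimately show ?thesis using stopping_cost_bounds(1)[of y \<tau>] by linarith
    qed
  qed (use assms in auto)
  then show ?thesis by simp
qed

lemma val_time_lipschitz:
  assumes "s \<ge> 0" "t \<ge> 0"
  shows "\<bar>val x s - val x t\<bar> \<le> (K + \<Lambda>\<^sup>2 / 2 + \<bar>L 0\<bar>) * \<bar>s - t\<bar>"
proof -
  have *: "\<bar>val x (t + h) - val x t\<bar> \<le> (K + \<Lambda>\<^sup>2 / 2 + \<bar>L 0\<bar>) * h" if "t \<ge> 0" "h > 0" for t h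
  proof -
    define C P D where "C = K + \<Lambda>\<^sup>2 / 2" and "P = C * h" and "D = \<bar>L 0\<bar> * h"
    have "0 \<le> P" "h * L 0 \<le> D" "0 \<le> D"
      using that K_nonneg by (auto simp: mult.commute C_def P_def D_def)
    moreover have "(C + \<bar>L 0\<bar>) * h = P + D"
      unfolding P_def D_def by (rule distrib_right)
    moreover have "val x (t + h) \<le> h * L 0 + val x t" using val_step[of h "t + h" x 0] that by simp
    moreover have "val x t \<le> val x (t + h) + P" using val_time_lower[OF that] by (simp add: C_def P_def)
    ultimately show ?thesis unfolding C_def[symmetric] abs_le_iff by linarith
  qed
  show ?thesis
    using *[of s "t - s"] *[of t "s - t"] assms
    by (cases s t rule: linorder_cases) (auto simp: abs_minus_commute)
qed

text \<open>Translating the stopping point together with \<open>x\<close> preserves velocity and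
  duration, so only the moduli of \<open>g\<close> and \<beta> enter, uniformly in
  \<open>t\<close>.\<close>

lemma val_space_modulus:
  assumes "e > 0"
  obtains d where "d > 0" "\<And>x x' t. t \<ge> 0 \<Longrightarrow> dist x x' < d \<Longrightarrow> \<bar>val x t - val x' t\<bar> \<le> e"
proof -
  obtain d1 where d1: "d1 > 0" "\<And>x x'. dist x' x < d1 \<Longrightarrow> dist (\<beta> x') (\<beta> x) < e"
    using uniformly_continuous_onE[OF \<beta>_uc assms] by auto
  have "uniformly_continuous_on UNIV g"
    using g_lipschitz by (rule lipschitz_on_uniformly_continuous)
  then obtain d2 where d2: "d2 > 0" "\<And>x x'. dist x' x < d2 \<Longrightarrow> dist (g x') (g x) < e"
    using assms by (auto elim: uniformly_continuous_onE)
  have *: "val x t \<le> val x' t + e" if "t \<ge> 0" "dist x x' < min d1 d2" for x x' t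
  proof (cases "t = 0")
    case True
    then show ?thesis using d2(2)[of x x'] that by (simp add: val_0 dist_real_def)
  next
    case False
    have "val x t - e \<le> val x' t"
    proof (rule le_valI)
      fix \<tau> y assume \<tau>: "0 \<le> \<tau>" "\<tau> < t"
      have "dist (y + (x - x')) y < min d1 d2" using that by (simp add: dist_norm)
      then have "stopping_cost g \<beta> (y + (x - x')) \<tau> \<le> stopping_cost g \<beta> y \<tau> + e"
        using d1(2)[of "y + (x - x')" y] d2(2)[of "y + (x - x')" y]
        by (auto simp: stopping_cost_def dist_real_def)
      moreover have "x - (y + (x - x')) = x' - y" by simp
      moreover have "val x t \<le> cost x t \<tau> (y + (x - x'))" using \<tau> by (rule val_le_cost)
      ultimately show "val x t - e \<le> cost x' t \<tau> y" by (simp add: cost_def)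
    qed (use False that in auto)
    then show ?thesis by simp
  qed
  show thesis
    using *[of t x x' for t x x'] *[of t x' x for t x x'] d1(1) d2(1)
    by (intro that[of "min d1 d2"]) (auto simp: abs_le_iff dist_commute algebra_simps)
qed

lemma val_uniformly_continuous: "uniformly_continuous_on (UNIV \<times> {0..}) (\<lambda>(x, t). val x t)"
  unfolding uniformly_continuous_on_def
proof (intro allI impI)
  fix e :: real assume "e > 0"
  obtain d where d: "d > 0" "\<And>x x' t. t \<ge> 0 \<Longrightarrow> dist x x' < d \<Longrightarrow> \<bar>val x t - val x' t\<bar> \<le> e / 3"
    using val_space_modulus[of "e / 3"] \<open>e > 0\<close> by auto
  define M where "M = K + \<Lambda>\<^sup>2 / 2 + \<bar>L 0\<bar> + 1"
  have "M > 0" using K_nonneg by (simp add: M_def add_nonneg_pos)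
  have "dist (val x' t') (val x t) < e"
    if "t \<ge> 0" "t' \<ge> 0" "dist (x', t') (x, t) < min d (e / (3 * M))" for x x' t t'
  proof -
    have "dist x' x < d" using that dist_fst_le[of "(x', t')" "(x, t)"] by simp
    then have 1: "\<bar>val x' t' - val x t'\<bar> \<le> e / 3" using d that by simp
    have "\<bar>t' - t\<bar> < e / (3 * M)"
      using that dist_snd_le[of "(x', t')" "(x, t)"] by (simp add: dist_real_def)
    then have "M * \<bar>t' - t\<bar> < e / 3" using \<open>M > 0\<close> by (simp add: field_simps)
    moreover have "(K + \<Lambda>\<^sup>2 / 2 + \<bar>L 0\<bar>) * \<bar>t' - t\<bar> \<le> M * \<bar>t' - t\<bar>"
      by (intro mult_right_mono) (auto simp: M_def)
    ultimately have "\<bar>val x t' - val x t\<bar> < e / 3"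
      using val_time_lipschitz[of t' t x] that by linarith
    with 1 \<open>e > 0\<close> show ?thesis by (simp add: dist_real_def abs_if split: if_splits)
  qed
  then show "\<exists>d>0. \<forall>X\<in>UNIV \<times> {0..}. \<forall>X'\<in>UNIV \<times> {0..}.
      dist X' X < d \<longrightarrow> dist (case X' of (x, t) \<Rightarrow> val x t) (case X of (x, t) \<Rightarrow> val x t) < e"
    using d(1) \<open>e > 0\<close> \<open>M > 0\<close> by (intro exI[of _ "min d (e / (3 * M))"]) auto
qed

text \<open>The touching point is compared with the earlier point reached backwards along a velocity
  that gives equality in Fenchel's inequality at \<open>q\<close>. If \<open>s + H q\<close> were
  positive, \<open>val_step\<close> would contradict the expansion of \<phi>.\<close>

lemma val_subsolution:
  assumes "t > 0" "GDERIV \<phi> (x, t) :> (q, s)"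
    and max: "\<forall>\<^sub>F Y in at (x, t) within UNIV \<times> {0<..}.
      (case Y of (x, t) \<Rightarrow> val x t) - \<phi> Y \<le> val x t - \<phi> (x, t)"
  shows "s + H q \<le> 0"
proof -
  obtain v where v: "H q \<le> q \<bullet> v - L v" using fenchel_attained by blast
  define A where "A = s + q \<bullet> v - L v"
  have "A \<le> 0"
  proof (rule ccontr)
    assume "\<not> A \<le> 0"
    then have "A / (2 * (norm v + 1)) > 0" by (simp add: add_nonneg_pos)
    then obtain d where d: "d > 0" "\<And>z. norm z < d \<Longrightarrow>
        \<bar>\<phi> ((x, t) + z) - \<phi> (x, t) - z \<bullet> (q, s)\<bar> \<le> A / (2 * (norm v + 1)) * norm z"
      using GDERIV_error[OF assms(2)] by blast
    obtain r where r: "r > 0" "\<And>y \<tau>. \<tau> > 0 \<Longrightarrow> dist (y, \<tau>) (x, t) < r \<Longrightarrow>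
        val y \<tau> - \<phi> (y, \<tau>) \<le> val x t - \<phi> (x, t)"
      using max unfolding eventually_at by (force simp: mem_Times_iff)
    \<comment> \<open>\<open>t / 2\<close> keeps the time positive; since
      \<open>norm z \<le> h * (norm v + 1)\<close>, the other entry puts \<open>z\<close> within
      reach of both the expansion and the touching condition.\<close>
    define h where "h = min (t / 2) (min d r / (2 * (norm v + 1)))"
    have nv: "norm v + 1 > 0" by (simp add: add_nonneg_pos)
    have h: "0 < h" "h < t" using assms d r nv by (auto simp: h_def)
    have "h * (norm v + 1) \<le> min d r / (2 * (norm v + 1)) * (norm v + 1)"
      using nv by (intro mult_right_mono) (auto simp: h_def)
    also have "\<dots> = min d r / 2" using nv by (simp add: divide_simps)
    finally have hd: "h * (norm v + 1) < min d r" using d(1) r(1) by simp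
    define z where "z = (- h *\<^sub>R v, - h)"
    have z: "norm z \<le> h * (norm v + 1)"
      using norm_Pair_le[of "- h *\<^sub>R v" "- h"] h by (simp add: z_def algebra_simps)
    have xz: "(x, t) + z = (x - h *\<^sub>R v, t - h)" by (simp add: z_def)
    have "val (x - h *\<^sub>R v) (t - h) - \<phi> (x - h *\<^sub>R v, t - h) \<le> val x t - \<phi> (x, t)"
    proof (rule r(2))
      show "dist (x - h *\<^sub>R v, t - h) (x, t) < r"
        using z hd unfolding xz[symmetric] by (simp add: dist_norm)
    qed (use h in auto)
    moreover have "val x t \<le> h * L v + val (x - h *\<^sub>R v) (t - h)"
      using h by (intro val_step) auto
    moreover have "\<bar>\<phi> (x - h *\<^sub>R v, t - h) - \<phi> (x, t) - z \<bullet> (q, s)\<bar> \<le> A / (2 * (norm v + 1)) * norm z"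
      using d(2)[of z] z hd xz by simp
    moreover have "A / (2 * (norm v + 1)) * norm z \<le> A / (2 * (norm v + 1)) * (h * (norm v + 1))"
      using z \<open>A / (2 * (norm v + 1)) > 0\<close> by (intro mult_left_mono) auto
    moreover have "A / (2 * (norm v + 1)) * (h * (norm v + 1)) = h * A / 2"
      using nv by (simp add: field_simps)
    moreover have "z \<bullet> (q, s) = - (h * A) - h * L v"
      by (simp add: z_def inner_Pair A_def algebra_simps inner_commute)
    ultimately have "h * A \<le> h * A / 2" by linarith
    then show False using \<open>\<not> A \<le> 0\<close> h by (simp add: mult_pos_pos)
  qed
  with v show ?thesis by (simp add: A_def)
qed

text \<open>Strictly below the obstacle, stopping after a very short duration is not nearly optimal:
  stopping near \<open>x\<close> pays almost \<open>\<beta> x\<close> or more, and reaching distant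
  points quickly costs too much.\<close>

lemma near_minimizer_time_gap:
  assumes "t > 0" "val x t < \<beta> x"
  obtains s\<^sub>0 \<eta> where "0 < s\<^sub>0" "0 < \<eta>"
    "\<And>\<tau> y. 0 \<le> \<tau> \<Longrightarrow> \<tau> < t \<Longrightarrow> cost x t \<tau> y < val x t + \<eta> \<Longrightarrow> s\<^sub>0 \<le> t - \<tau>"
proof -
  define \<eta> where "\<eta> = (\<beta> x - val x t) / 4"
  have "\<eta> > 0" using assms by (simp add: \<eta>_def)
  obtain \<delta> where \<delta>: "\<delta> > 0" "\<And>x x'. dist x' x < \<delta> \<Longrightarrow> dist (\<beta> x') (\<beta> x) < \<eta>"
    using uniformly_continuous_onE[OF \<beta>_uc \<open>\<eta> > 0\<close>] by auto
  \<comment> \<open>For a duration \<open>k\<close> below this minimum, the entries give a positive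
    stopping time, so that the payoff is \<open>\<beta>\<close>, then \<open>K * k < \<eta>\<close>,
    then a kinetic cost of at least \<open>2 * B\<close> at distance \<delta> or more. The summands
    1 exclude division by 0.\<close>
  define s\<^sub>0 where "s\<^sub>0 = min t (min (\<eta> / (K + 1)) (\<delta>\<^sup>2 / (4 * B + 1)))"
  have "s\<^sub>0 > 0" using assms \<open>\<eta> > 0\<close> \<delta> K_nonneg B_nonneg by (simp add: s\<^sub>0_def)
  moreover have "s\<^sub>0 \<le> t - \<tau>" if \<tau>: "0 \<le> \<tau>" "\<tau> < t" and near: "cost x t \<tau> y < val x t + \<eta>" for \<tau> y
  proof (rule ccontr)
    assume "\<not> s\<^sub>0 \<le> t - \<tau>"
    define k where "k = t - \<tau>"
    have k: "0 < k" "k < t" "k < \<eta> / (K + 1)" "k < \<delta>\<^sup>2 / (4 * B + 1)"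
      using \<tau> \<open>\<not> s\<^sub>0 \<le> t - \<tau>\<close> by (auto simp: k_def s\<^sub>0_def)
    have "K * k \<le> (K + 1) * k" using k by simp
    also have "\<dots> < \<eta>" using k K_nonneg by (simp add: pos_less_divide_eq mult.commute)
    finally have Kk: "K * k < \<eta>" .
    have "\<tau> > 0" using k by (simp add: k_def)
    then have c: "(norm (x - y))\<^sup>2 / (2 * k) - K * k + \<beta> y \<le> cost x t \<tau> y"
      using cost_ge_norm[OF \<tau>(2), of x y] by (simp add: k_def stopping_cost_def)
    have "\<beta> x - 2 * \<eta> < cost x t \<tau> y"
    proof (cases "dist x y < \<delta>")
      case True
      then have "\<beta> x - \<eta> < \<beta> y" using \<delta>(2)[of x y] by (simp add: dist_real_def)
      moreover have "0 \<le> (norm (x - y))\<^sup>2 / (2 * k)" using k by simp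
      ultimately show ?thesis using c Kk by linarith
    next
      case False
      have "(4 * B + 1) * k < \<delta>\<^sup>2"
        using k B_nonneg by (simp add: pos_less_divide_eq mult.commute)
      also have "\<dots> \<le> (norm (x - y))\<^sup>2"
        using False \<delta>(1) by (intro power_mono) (auto simp: dist_norm)
      finally have "2 * B * (2 * k) \<le> (norm (x - y))\<^sup>2" using k by (simp add: algebra_simps)
      then have "2 * B \<le> (norm (x - y))\<^sup>2 / (2 * k)" using k by (simp add: pos_le_divide_eq)
      then show ?thesis using c Kk \<beta>_bound[of x] \<beta>_bound[of y] \<open>\<eta> > 0\<close> by linarith
    qed
    moreover have "\<beta> x = val x t + 4 * \<eta>" by (simp add: \<eta>_def diff_divide_distrib)
    ultimately show False using near \<open>\<eta> > 0\<close> by linarith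
  qed
  ultimately show thesis using that \<open>\<eta> > 0\<close> by blast
qed

text \<open>The remainder of a nearly optimal straight path after time \<open>h\<close> is a
  competitor at the point reached, which reverses \<open>val_step\<close> up to a small error. The
  time gap ensures that the path lasts longer than \<open>h\<close> and bounds its velocity.\<close>

lemma val_supersolution:
  assumes "t > 0" "val x t < \<beta> x" "GDERIV \<phi> (x, t) :> (q, s)"
    and min: "\<forall>\<^sub>F Y in at (x, t) within UNIV \<times> {0<..}.
      (case Y of (x, t) \<Rightarrow> val x t) - \<phi> Y \<ge> val x t - \<phi> (x, t)"
  shows "s + H q \<ge> 0"
proof (rule ccontr)
  assume neg: "\<not> s + H q \<ge> 0"
  obtain s\<^sub>0 \<eta>\<^sub>0 where s0: "0 < s\<^sub>0" "0 < \<eta>\<^sub>0"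
    "\<And>\<tau> y. 0 \<le> \<tau> \<Longrightarrow> \<tau> < t \<Longrightarrow> cost x t \<tau> y < val x t + \<eta>\<^sub>0 \<Longrightarrow> s\<^sub>0 \<le> t - \<tau>"
    using near_minimizer_time_gap[OF assms(1,2)] by blast
  \<comment> \<open>Near-minimizers satisfy \<open>(t - \<tau>) * L v \<le> E\<close>; division by
    the time gap and the quadratic lower bound on \<open>L\<close> give
    \<open>(norm v)\<^sup>2 \<le> V\<close>.\<close>
  define E where "E = \<bar>val x t\<bar> + \<eta>\<^sub>0 + B"
  define V where "V = 2 * (K + E / s\<^sub>0) + 1"
  have "E \<ge> 0" using s0 B_nonneg by (simp add: E_def)
  have V1: "V \<ge> 1" using \<open>E \<ge> 0\<close> K_nonneg s0 by (simp add: V_def)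
  have V: "norm ((x - y) /\<^sub>R (t - \<tau>)) \<le> V"
    if "0 \<le> \<tau>" "\<tau> < t" "cost x t \<tau> y < val x t + \<eta>\<^sub>0" for \<tau> y
  proof -
    define v where "v = (x - y) /\<^sub>R (t - \<tau>)"
    have "(t - \<tau>) * L v \<le> E"
      using that(3) stopping_cost_bounds(3)[of y \<tau>] by (simp add: cost_def E_def v_def)
    then have "L v \<le> E / (t - \<tau>)" using that by (simp add: pos_le_divide_eq mult.commute)
    also have "\<dots> \<le> E / s\<^sub>0" using s0 that \<open>E \<ge> 0\<close> by (intro divide_left_mono) auto
    finally have "(norm v)\<^sup>2 \<le> V" using L_ge[of v] by (simp add: V_def)
    also have "\<dots> \<le> V\<^sup>2" using V1 by (simp add: power2_eq_square)
    finally have "norm v \<le> V" by (rule power2_le_imp_le) (use V1 in simp)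
    then show ?thesis by (simp only: v_def)
  qed
  \<comment> \<open>With half the violation as unit, the near-minimizer loses
    \<open>h * \<eta>\<close> and the expansion \<open>h * \<eta> / 2\<close>, together less than
    the violation \<open>2 * (h * \<eta>)\<close>.\<close>
  define \<eta> where "\<eta> = - (s + H q) / 2"
  have s: "s = - H q - 2 * \<eta>" by (simp add: \<eta>_def field_simps)
  have "\<eta> > 0" using neg by (simp add: \<eta>_def)
  then have "\<eta> / (2 * (V + 1)) > 0" using V1 by simp
  then obtain d where d: "d > 0" "\<And>z. norm z < d \<Longrightarrow>
      \<bar>\<phi> ((x, t) + z) - \<phi> (x, t) - z \<bullet> (q, s)\<bar> \<le> \<eta> / (2 * (V + 1)) * norm z"
    using GDERIV_error[OF assms(3)] by blast
  obtain r where r: "r > 0" "\<And>y \<tau>. \<tau> > 0 \<Longrightarrow> dist (y, \<tau>) (x, t) < r \<Longrightarrow>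
      val y \<tau> - \<phi> (y, \<tau>) \<ge> val x t - \<phi> (x, t)"
    using min unfolding eventually_at by (force simp: mem_Times_iff)
  \<comment> \<open>The middle entry gives \<open>h * \<eta> \<le> \<eta>\<^sub>0\<close>, so the
    near-minimizer picked for this \<open>h\<close> obeys the time gap and the velocity bound, both
    fixed beforehand.\<close>
  define h where "h = min (s\<^sub>0 / 2) (min (\<eta>\<^sub>0 / \<eta>) (min d r / (2 * (V + 1))))"
  have h: "0 < h" "h < s\<^sub>0" "h \<le> \<eta>\<^sub>0 / \<eta>"
    using s0 d r V1 \<open>\<eta> > 0\<close> by (auto simp: h_def)
  then have "h * \<eta> \<le> \<eta>\<^sub>0" using \<open>\<eta> > 0\<close> by (simp add: pos_le_divide_eq)
  have "h * (V + 1) \<le> min d r / (2 * (V + 1)) * (V + 1)"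
    using V1 by (intro mult_right_mono) (auto simp: h_def)
  also have "\<dots> = min d r / 2" using V1 by (simp add: divide_simps)
  finally have hd: "h * (V + 1) < min d r" using d(1) r(1) by simp
  have "h * \<eta> > 0" using h \<open>\<eta> > 0\<close> by simp
  then obtain \<tau> y where \<tau>: "0 \<le> \<tau>" "\<tau> < t" and near: "cost x t \<tau> y < val x t + h * \<eta>"
    using val_near_minimizer[OF assms(1)] by blast
  have near': "cost x t \<tau> y < val x t + \<eta>\<^sub>0" using near \<open>h * \<eta> \<le> \<eta>\<^sub>0\<close> by simp
  define k where "k = t - \<tau>"
  have k: "h < k" "t - h - \<tau> = k - h" "t - \<tau> = k" using s0(3)[OF \<tau> near'] h by (auto simp: k_def)
  define v where "v = (x - y) /\<^sub>R k"
  have nv: "norm v \<le> V" using V[OF \<tau> near'] by (simp add: v_def k_def)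
  have "k *\<^sub>R v = x - y" using k h by (simp add: v_def)
  then have "(x - h *\<^sub>R v - y) = (k - h) *\<^sub>R v" by (simp add: algebra_simps)
  then have "(x - h *\<^sub>R v - y) /\<^sub>R (k - h) = v" using k by simp
  then have "cost (x - h *\<^sub>R v) (t - h) \<tau> y = (k - h) * L v + stopping_cost g \<beta> y \<tau>"
    unfolding cost_def k(2) by simp
  moreover have "cost x t \<tau> y = k * L v + stopping_cost g \<beta> y \<tau>"
    unfolding cost_def k(3) v_def by simp
  moreover have "val (x - h *\<^sub>R v) (t - h) \<le> cost (x - h *\<^sub>R v) (t - h) \<tau> y"
    using \<tau> k by (intro val_le_cost) linarith+
  ultimately have dpp: "h * L v + val (x - h *\<^sub>R v) (t - h) < val x t + h * \<eta>"
    using near by (simp add: algebra_simps)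
  define z where "z = (- h *\<^sub>R v, - h)"
  have "norm z \<le> h * (norm v + 1)"
    using norm_Pair_le[of "- h *\<^sub>R v" "- h"] h by (simp add: z_def algebra_simps)
  also have "\<dots> \<le> h * (V + 1)" using nv h by (intro mult_left_mono) auto
  finally have z: "norm z \<le> h * (V + 1)" .
  have xz: "(x, t) + z = (x - h *\<^sub>R v, t - h)" by (simp add: z_def)
  have "val (x - h *\<^sub>R v) (t - h) - \<phi> (x - h *\<^sub>R v, t - h) \<ge> val x t - \<phi> (x, t)"
  proof (rule r(2))
    show "dist (x - h *\<^sub>R v, t - h) (x, t) < r"
      using z hd unfolding xz[symmetric] by (simp add: dist_norm)
  qed (use k \<tau> in linarith)
  moreover have "\<bar>\<phi> (x - h *\<^sub>R v, t - h) - \<phi> (x, t) - z \<bullet> (q, s)\<bar> \<le> h * \<eta> / 2"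
  proof -
    have "\<bar>\<phi> (x - h *\<^sub>R v, t - h) - \<phi> (x, t) - z \<bullet> (q, s)\<bar> \<le> \<eta> / (2 * (V + 1)) * norm z"
      using d(2)[of z] z hd xz by simp
    also have "\<dots> \<le> \<eta> / (2 * (V + 1)) * (h * (V + 1))"
      using z \<open>\<eta> / (2 * (V + 1)) > 0\<close> by (intro mult_left_mono) auto
    also have "\<dots> = h * \<eta> / 2"
      using V1 by (simp add: field_simps)
    finally show ?thesis .
  qed
  moreover have "z \<bullet> (q, s) = - (h * (q \<bullet> v + s))"
    by (simp add: z_def inner_Pair algebra_simps inner_commute)
  moreover have "h * (q \<bullet> v - H q) \<le> h * L v" using fenchel h by (intro mult_left_mono) auto
  moreover have "h * (q \<bullet> v + s) = h * (q \<bullet> v - H q) - 2 * (h * \<eta>)"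
    unfolding s by (simp add: right_diff_distrib distrib_left)
  ultimately have "2 * (h * \<eta>) < h * \<eta> + h * \<eta> / 2" using dpp by linarith
  then show False using \<open>h * \<eta> > 0\<close> by argo
qed

lemma val_obstacle_solution: "obstacle_solution \<beta> H g val"
proof -
  let ?F = "\<lambda>(x, t) r (q, s). max (r - \<beta> x) (s + H q)"
  have "viscosity_subsolution ?F (UNIV \<times> {0<..}) (\<lambda>(x, t). val x t)"
    unfolding viscosity_subsolution_def
    using val_subsolution val_le_obstacle by fastforce
  \<comment> \<open>Where \<open>val\<close> reaches the obstacle the maximum is already
    nonnegative, so testing matters only strictly below it.\<close>
  moreover have "viscosity_supersolution ?F (UNIV \<times> {0<..}) (\<lambda>(x, t). val x t)"
    unfolding viscosity_supersolution_def
    using val_supersolution by (fastforce simp: le_max_iff_disj not_le)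
  ultimately show ?thesis
    using val_uniformly_continuous by (simp add: obstacle_solution_def val_0)
qed

end

section \<open>The representation formula\<close>

text \<open>A minimizer at \<open>x'\<close> is a competitor at \<open>x\<close>, so the modulus of
  \<open>b\<close> passes to the minimum; the minima are values of \<open>b\<close>, hence
  bounded.\<close>

lemma bbar_BUC:
  fixes b :: "real^'n \<Rightarrow> real^'n \<Rightarrow> real"
  assumes per: "\<Omega> + integer_lattice = \<Omega>" and ne: "frontier \<Omega> \<noteq> {}"
    and buc: "BUC_on (UNIV \<times> frontier \<Omega>) (\<lambda>(x, y). b x y)"
    and bper: "\<And>x y z. y \<in> frontier \<Omega> \<Longrightarrow> z \<in> integer_lattice \<Longrightarrow> b x (y + z) = b x y"
  shows "BUC_on UNIV (bbar b \<Omega>)"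
proof -
  note attained = bbar_attained[OF per ne buc bper]
  have "uniformly_continuous_on UNIV (bbar b \<Omega>)"
    unfolding uniformly_continuous_on_def
  proof (intro allI impI)
    fix e :: real assume "e > 0"
    have "uniformly_continuous_on (UNIV \<times> frontier \<Omega>) (\<lambda>(x, y). b x y)"
      using buc by (simp add: BUC_on_def)
    then obtain d where d: "d > 0" "\<And>a a'. a \<in> UNIV \<times> frontier \<Omega> \<Longrightarrow> a' \<in> UNIV \<times> frontier \<Omega> \<Longrightarrow>
        dist a' a < d \<Longrightarrow> dist (case a' of (x, y) \<Rightarrow> b x y) (case a of (x, y) \<Rightarrow> b x y) < e"
      using \<open>e > 0\<close> by (rule uniformly_continuous_onE) blast
    have *: "bbar b \<Omega> x < bbar b \<Omega> x' + e" if "dist x x' < d" for x x'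
    proof -
      obtain z where z: "z \<in> frontier \<Omega>" "bbar b \<Omega> x' = b x' z" by (rule attained[of x'])
      have "bbar b \<Omega> x \<le> b x z" by (rule attained[of x]) (use z in auto)
      moreover have "dist (b x z) (b x' z) < e"
        using d(2)[of "(x', z)" "(x, z)"] z that by (simp add: dist_Pair_Pair)
      ultimately show ?thesis using z by (simp add: dist_real_def)
    qed
    have "dist (bbar b \<Omega> x') (bbar b \<Omega> x) < e" if "dist x' x < d" for x x'
      using *[of x x'] *[of x' x] that by (auto simp: dist_commute dist_real_def)
    then show "\<exists>d>0. \<forall>x\<in>UNIV. \<forall>x'\<in>UNIV. dist x' x < d \<longrightarrow> dist (bbar b \<Omega> x') (bbar b \<Omega> x) < e"
      using d(1) by blast
  qed
  moreover have "bounded (range (bbar b \<Omega>))"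
  proof (rule bounded_subset)
    show "bounded ((\<lambda>(x, y). b x y) ` (UNIV \<times> frontier \<Omega>))" using buc by (simp add: BUC_on_def)
    show "range (bbar b \<Omega>) \<subseteq> (\<lambda>(x, y). b x y) ` (UNIV \<times> frontier \<Omega>)"
    proof
      fix r assume "r \<in> range (bbar b \<Omega>)"
      then obtain x where "r = bbar b \<Omega> x" by blast
      moreover obtain z where "z \<in> frontier \<Omega>" "bbar b \<Omega> x = b x z" by (rule attained[of x])
      ultimately show "r \<in> (\<lambda>(x, y). b x y) ` (UNIV \<times> frontier \<Omega>)" by force
    qed
  qed
  ultimately show ?thesis by (simp add: BUC_on_def)
qed

text \<open>Coercivity is quadratic growth of \<open>h\<close>, so Young's inequality absorbs
  \<open>p \<bullet> v\<close>. Where \<open>h p + c\<close> is negative it only bounds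
  \<open>p\<close>, and an affine minorant from convexity bounds \<open>- h p\<close>.\<close>

lemma legendre_finite:
  fixes h :: "'a::euclidean_space \<Rightarrow> real"
  assumes convex: "convex_on UNIV h"
    and coercive: "\<And>p. norm p \<le> K * (sqrt (2 * max 0 (h p + c)) + 1)" and "K \<ge> 0"
  shows "bdd_above (range (\<lambda>p. p \<bullet> v - h p))"
proof -
  obtain u where u: "\<And>p. h p \<ge> h 0 + u \<bullet> (p - 0)"
    using convex_on_UNIV_subgradient[OF convex] by blast
  have "p \<bullet> v - h p \<le> (norm v * K)\<^sup>2 / 2 + norm v * K + \<bar>c\<bar> + \<bar>h 0\<bar> + norm u * K" for p
  proof -
    define M where "M = sqrt (2 * max 0 (h p + c))"
    have M: "M\<^sup>2 = 2 * max 0 (h p + c)" by (simp add: M_def)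
    have pK: "norm p \<le> K * (M + 1)" using coercive[of p] by (simp add: M_def)
    have "p \<bullet> v \<le> norm p * norm v" by (rule norm_cauchy_schwarz)
    also have "\<dots> \<le> K * (M + 1) * norm v" using pK by (intro mult_right_mono) auto
    finally have pv: "p \<bullet> v \<le> norm v * K * M + norm v * K" by (simp add: algebra_simps)
    have "0 \<le> (norm v * K - M)\<^sup>2" by simp
    then have am: "norm v * K * M \<le> (norm v * K)\<^sup>2 / 2 + M\<^sup>2 / 2"
      by (simp add: power2_diff algebra_simps)
    have nn: "0 \<le> norm u * K" using \<open>K \<ge> 0\<close> by simp
    show ?thesis
    proof (cases "h p + c \<ge> 0")
      case True
      then have "M\<^sup>2 / 2 = h p + c" using M by simp
      with pv am nn show ?thesis by linarith
    next
      case False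
      then have "M = 0" by (simp add: M_def)
      then have "norm p \<le> K" using pK by simp
      have "\<bar>u \<bullet> p\<bar> \<le> norm u * norm p" by (rule Cauchy_Schwarz_ineq2)
      also have "\<dots> \<le> norm u * K" using \<open>norm p \<le> K\<close> by (intro mult_left_mono) auto
      finally have "- h p \<le> \<bar>h 0\<bar> + norm u * K" using u[of p] by simp
      moreover have "0 \<le> (norm v * K)\<^sup>2 / 2" by simp
      moreover have "p \<bullet> v \<le> norm v * K" using pv \<open>M = 0\<close> by simp
      ultimately show ?thesis by linarith
    qed
  qed
  then show ?thesis by (intro bdd_aboveI2)
qed

lemma legendre_convex:
  fixes h :: "'a::real_inner \<Rightarrow> real"
  assumes bdd: "\<And>v. bdd_above (range (\<lambda>p. p \<bullet> v - h p))"
  shows "convex_on UNIV (legendre h)"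
proof (rule convex_onI)
  fix t :: real and x y :: 'a assume t: "0 < t" "t < 1"
  have le: "p \<bullet> v - h p \<le> legendre h v" for p v
    unfolding legendre_def using bdd by (intro cSUP_upper) auto
  show "legendre h ((1 - t) *\<^sub>R x + t *\<^sub>R y) \<le> (1 - t) * legendre h x + t * legendre h y"
    unfolding legendre_def[of h "(1 - t) *\<^sub>R x + t *\<^sub>R y"]
  proof (rule cSUP_least)
    fix p
    have "p \<bullet> ((1 - t) *\<^sub>R x + t *\<^sub>R y) - h p = (1 - t) * (p \<bullet> x - h p) + t * (p \<bullet> y - h p)"
      by (simp add: inner_add_right algebra_simps)
    also have "\<dots> \<le> (1 - t) * legendre h x + t * legendre h y"
      using t le by (intro add_mono mult_left_mono) auto
    finally show "p \<bullet> ((1 - t) *\<^sub>R x + t *\<^sub>R y) - h p \<le> (1 - t) * legendre h x + t * legendre h y" .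
  qed simp
qed simp

theorem proposition2p1:
  fixes \<Omega> :: "(real^'n) set"
    and H :: "real^'n \<Rightarrow> real^'n \<Rightarrow> real"
    and b :: "real^'n \<Rightarrow> real^'n \<Rightarrow> real"
    and g :: "real^'n \<Rightarrow> real"
    and K0 :: real
    and Hbar :: "real^'n \<Rightarrow> real"
    and u :: "real^'n \<Rightarrow> real \<Rightarrow> real"
  assumes dim: "CARD('n) \<ge> 2"
    and \<Omega>_open: "open \<Omega>" and \<Omega>_connected: "connected \<Omega>"
    and \<Omega>_periodic: "\<Omega> + integer_lattice = \<Omega>"
    and \<Omega>_boundary: "frontier \<Omega> \<noteq> {}" "C1_boundary \<Omega>"
    and H_cont: "continuous_on UNIV (\<lambda>(y, p). H y p)"
    and H_periodic: "\<And>y p z. z \<in> integer_lattice \<Longrightarrow> H (y + z) p = H y p"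
    and H_coercive: "filterlim (\<lambda>p. INF y. H y p) at_top at_infinity"
    and H_convex: "\<And>y. convex_on UNIV (H y)"
    and b_BUC: "BUC_on (UNIV \<times> frontier \<Omega>) (\<lambda>(x, y). b x y)"
    and b_periodic: "\<And>x y z. y \<in> frontier \<Omega> \<Longrightarrow> z \<in> integer_lattice \<Longrightarrow> b x (y + z) = b x y"
    and g_BUC: "BUC_on UNIV g" and g_Lip: "\<exists>L. L-lipschitz_on UNIV g"
    and g_le: "\<And>x. g x \<le> bbar b \<Omega> x"
    and K0_pos: "K0 > 0"
    and H_bounds: "\<And>y p. (norm p)\<^sup>2 / 2 - K0 \<le> H y p \<and> H y p \<le> (norm p)\<^sup>2 / 2 + K0"
    and Hbar: "effective_hamiltonian H \<Omega> Hbar"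
    and u: "unique_obstacle_solution (bbar b \<Omega>) Hbar g u"
  shows "\<forall>x. \<forall>t\<ge>0. u x t =
           (if t > 0
            then (INF (\<tau>, y) \<in> {0..<t} \<times> UNIV. (t - \<tau>) * legendre Hbar ((x - y) /\<^sub>R (t - \<tau>))
                    + stopping_cost g (bbar b \<Omega>) y \<tau>)
            else g x)"
proof -
  have "\<Omega> \<noteq> {}" using \<Omega>_boundary(1) by auto
  have H_ge: "(norm p)\<^sup>2 / 2 - K0 \<le> H y p" for y p using H_bounds by blast
  have "\<exists>v. cell_solution H \<Omega> p (Hbar p) v" for p
    using Hbar by (simp add: effective_hamiltonian_def)
  then obtain v where v: "\<And>p. cell_solution H \<Omega> p (Hbar p) (v p)" by metis
  have Hbar_le: "Hbar p \<le> (norm p)\<^sup>2 / 2 + K0" for p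
    using cell_constant_le[OF \<Omega>_periodic \<open>\<Omega> \<noteq> {}\<close> v] H_bounds by (meson order_trans)
  have Hbar_convex: "convex_on UNIV Hbar"
  proof (rule convex_onI)
    fix t :: real and p q assume "0 < t" "t < 1"
    then show "Hbar ((1 - t) *\<^sub>R p + t *\<^sub>R q) \<le> (1 - t) * Hbar p + t * Hbar q"
      by (intro cell_comparison_convex[OF \<Omega>_open \<Omega>_periodic \<open>\<Omega> \<noteq> {}\<close> \<Omega>_boundary(2) H_cont
            H_convex H_ge v v v]) auto
  qed simp
  obtain K where K: "K \<ge> 0"
    "\<And>p c v. cell_solution H \<Omega> p c v \<Longrightarrow> norm p \<le> K * (sqrt (2 * max 0 (c + K0)) + 1)"
    by (rule cell_solution_coercive[OF \<Omega>_open \<Omega>_connected \<Omega>_periodic \<open>\<Omega> \<noteq> {}\<close> H_ge]) (rule that)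
  \<comment> \<open>Boundedness makes the supremum in \<open>legendre\<close> genuine, as Fenchel's
    inequality requires.\<close>
  have bdd: "bdd_above (range (\<lambda>p. p \<bullet> v - Hbar p))" for v
    using legendre_finite[OF Hbar_convex K(2)[OF v] K(1)] .
  have fenchel: "q \<bullet> v - Hbar q \<le> legendre Hbar v" for q v
    unfolding legendre_def using bdd by (intro cSUP_upper) auto
  have bbar: "BUC_on UNIV (bbar b \<Omega>)"
    by (rule bbar_BUC[OF \<Omega>_periodic \<Omega>_boundary(1) b_BUC b_periodic])
  obtain B1 B2 where B: "\<And>x. \<bar>g x\<bar> \<le> B1" "\<And>x. \<bar>bbar b \<Omega> x\<bar> \<le> B2"
    using g_BUC bbar unfolding BUC_on_def bounded_iff by (metis rangeI real_norm_def)
  obtain \<Lambda> where \<Lambda>: "\<Lambda>-lipschitz_on UNIV g" using g_Lip by blast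
  interpret hopf_lax "legendre Hbar" Hbar g "bbar b \<Omega>" K0 "max B1 B2" \<Lambda>
  proof
    show "convex_on UNIV (legendre Hbar)" using bdd by (rule legendre_convex)
    \<comment> \<open>The choice \<open>p = v\<close> in the supremum turns the upper bound on
      \<open>Hbar\<close> into this lower bound.\<close>
    show "(norm v)\<^sup>2 / 2 - K0 \<le> legendre Hbar v" for v
      using fenchel[of v v] Hbar_le[of v] by (simp add: power2_norm_eq_inner)
    show "\<exists>v. Hbar q \<le> q \<bullet> v - legendre Hbar v" for q
    proof -
      \<comment> \<open>For a subgradient \<open>v\<close> at \<open>q\<close>, the supremum
        defining \<open>legendre Hbar v\<close> is attained at \<open>q\<close>.\<close>
      obtain v where v: "\<And>p. Hbar p \<ge> Hbar q + v \<bullet> (p - q)"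
        using convex_on_UNIV_subgradient[OF Hbar_convex] by blast
      have "legendre Hbar v \<le> q \<bullet> v - Hbar q"
        unfolding legendre_def
      proof (rule cSUP_least)
        show "p \<bullet> v - Hbar p \<le> q \<bullet> v - Hbar q" for p
          using v[of p] by (simp add: inner_diff_right inner_commute)
      qed simp
      then show ?thesis by (intro exI[of _ v]) simp
    qed
    show "uniformly_continuous_on UNIV (bbar b \<Omega>)" using bbar by (simp add: BUC_on_def)
    show "\<bar>g x\<bar> \<le> max B1 B2" "\<bar>bbar b \<Omega> x\<bar> \<le> max B1 B2" for x
      using B[of x] by auto
    show "0 \<le> K0" using K0_pos by simp
    show "q \<bullet> v - Hbar q \<le> legendre Hbar v" for q v by (rule fenchel)
    show "\<Lambda>-lipschitz_on UNIV g" by (rule \<Lambda>)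
    show "g x \<le> bbar b \<Omega> x" for x by (rule g_le)
  qed
  have "val x t = u x t" if "t \<ge> 0" for x t
    using u val_obstacle_solution that by (simp add: unique_obstacle_solution_def)
  then show ?thesis unfolding val_def cost_def by auto
qed

end
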